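(* Let $p\ge2$ and let $\mu$ be a Borel probability measure on $\mathbb S^{p-1}$ such that $I_\mu(u):=\int_{\mathbb S^{p-1}}|a^\top u|^{-1}\,\mu(\mathrm da)<\infty$ for Haar-almost every $u\in\mathbb S^{p-1}$; where this is finite put $g_\mu(u):=\int_{\mathbb S^{p-1}}\frac{a}{a^\top u}\,\mu(\mathrm da)$. Let $(U,V)$ be a Haar oriented orthonormal two-frame in $\mathbb R^p$ and let $P=\operatorname{span}\{U,V\}$ with its induced orientation. For Haar-almost every oriented plane $P$, the angular pushforward modulo $\pi$ of $\mu$ under orthogonal projection onto $P$ is a probability measure on $\mathbb R/(\pi\mathbb Z)$ that is singular with respect to Lebesgue measure, and $$\mathcal L\{g_\mu(U)^\top V\mid P\}=\mathrm{Cauchy}(0,1).$$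
   Context: The integrand $1/|a^\top u|$ is $+\infty$ when $a^\top u=0$. A Haar oriented orthonormal two-frame is distributed as the first two columns of a Haar matrix in $O(p)$; $\mathcal L\{\cdot\mid P\}$ denotes the conditional law given $P$. For an oriented plane $P$ with positive orthonormal basis $(e_1,e_2)$ and $a$ not orthogonal to $P$, write $\operatorname{proj}_P(a)=r_P(a)\{e_1\cos\widetilde\alpha_P(a)+e_2\sin\widetilde\alpha_P(a)\}$ with $r_P(a)>0$, and let $\alpha_P(a)$ be the class of $\widetilde\alpha_P(a)$ modulo $\pi$. For almost every $P$ one has $\mu(P^\perp\cap\mathbb S^{p-1})=0$, and the angular pushforward of $\mu$ is $\nu_P=(\alpha_P)_\#\mu$ (with $\alpha_P$ defined arbitrarily on this $\mu$-null set). *)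

theory Defs
  imports "HOL-Probability.Probability" "HOL-Library.Real_Mod"
begin

section \<open>Haar measures and Haar frames\<close>

text \<open>
  The predicates \<open>haar_orthogonal\<close> and \<open>haar_sphere\<close> are the usual defining properties of the
  (unique) invariant probability measures on \<open>O(p)\<close> and on the unit sphere, with \<open>p = CARD('n)\<close>.
\<close>

definition haar_orthogonal :: "(real^'n^'n) measure \<Rightarrow> bool" where
  "haar_orthogonal H \<longleftrightarrow>
     prob_space H \<and>
     sets H = sets (restrict_space borel {Q. orthogonal_matrix Q}) \<and>
     (\<forall>R. orthogonal_matrix R \<longrightarrow> distr H H (\<lambda>Q. R ** Q) = H)"

definition haar_sphere :: "(real^'n) measure \<Rightarrow> bool" where
  "haar_sphere \<sigma> \<longleftrightarrow>
     prob_space \<sigma> \<and>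
     sets \<sigma> = sets (restrict_space borel (sphere 0 1)) \<and>
     (\<forall>R. orthogonal_matrix R \<longrightarrow> distr \<sigma> \<sigma> (\<lambda>u. R *v u) = \<sigma>)"

definition orthonormal_frames :: "((real^'n) \<times> (real^'n)) set" where
  "orthonormal_frames = {(u, v). norm u = 1 \<and> norm v = 1 \<and> u \<bullet> v = 0}"

definition frame_space :: "((real^'n) \<times> (real^'n)) measure" where
  "frame_space = restrict_space borel orthonormal_frames"

text \<open>
  The index type \<open>'n\<close> is not ordered, so the first two columns are replaced by any two
  distinct columns; the law does not depend on the choice, because Haar measure is invariant
  under permutations of the columns.
\<close>

definition haar_two_frame ::
    "'w measure \<Rightarrow> ('w \<Rightarrow> real^'n) \<Rightarrow> ('w \<Rightarrow> real^'n) \<Rightarrow> bool" where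
  "haar_two_frame M U V \<longleftrightarrow>
     prob_space M \<and>
     (\<lambda>\<omega>. (U \<omega>, V \<omega>)) \<in> measurable M frame_space \<and>
     (\<exists>H i j. haar_orthogonal H \<and> i \<noteq> j \<and>
        distr M frame_space (\<lambda>\<omega>. (U \<omega>, V \<omega>)) =
        distr H frame_space (\<lambda>Q. (column i Q, column j Q)))"

section \<open>Oriented planes\<close>

text \<open>
  An oriented plane is represented by the set of its positive orthonormal bases. For an
  orthonormal pair \<open>(u, v)\<close> the real number required to be positive is the determinant of the
  change of basis from \<open>(u, v)\<close> to \<open>(x, y)\<close>.
\<close>

type_synonym 'n oriented_plane = "((real^'n) \<times> (real^'n)) set"

definition oriented_span :: "real^'n \<Rightarrow> real^'n \<Rightarrow> 'n oriented_plane" where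
  "oriented_span u v =
     {(x, y) \<in> orthonormal_frames.
        span {x, y} = span {u, v} \<and> (x \<bullet> u) * (y \<bullet> v) - (x \<bullet> v) * (y \<bullet> u) > 0}"

text \<open>
  The space of oriented planes carries the quotient of the Borel sigma-algebra on frames.
\<close>

definition oriented_planes :: "('n::finite) oriented_plane measure" where
  "oriented_planes =
     sigma ((\<lambda>(u, v). oriented_span u v) ` orthonormal_frames)
       {A. A \<subseteq> (\<lambda>(u, v). oriented_span u v) ` orthonormal_frames \<and>
           {(u, v) \<in> orthonormal_frames. oriented_span u v \<in> A} \<in> sets frame_space}"

section \<open>Angular pushforward modulo pi\<close>

text \<open>
  The group \<open>\<real>/\<pi>\<int>\<close> is represented by the fundamental domain \<open>{0..<pi}\<close> with its Borel sets; the
  class of \<open>s\<close> is represented by \<open>s rmod pi\<close>.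
\<close>

definition circle_mod_pi :: "real measure" where
  "circle_mod_pi = restrict_space borel {0..<pi}"

definition lebesgue_mod_pi :: "real measure" where
  "lebesgue_mod_pi = restrict_space lborel {0..<pi}"

definition plane_proj :: "real^'n \<Rightarrow> real^'n \<Rightarrow> real^'n \<Rightarrow> real^'n" where
  "plane_proj e1 e2 a = (a \<bullet> e1) *\<^sub>R e1 + (a \<bullet> e2) *\<^sub>R e2"

text \<open>
  For \<open>a\<close> orthogonal to the plane the value is arbitrary; it is set to \<open>0\<close>. A different positive
  orthonormal basis of the same oriented plane changes the angle by a constant rotation.
\<close>

definition plane_angle :: "real^'n \<Rightarrow> real^'n \<Rightarrow> real^'n \<Rightarrow> real" where
  "plane_angle e1 e2 a =
     (if plane_proj e1 e2 a = 0 then 0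
      else THE t. \<exists>r s. r > 0 \<and> plane_proj e1 e2 a = r *\<^sub>R (cos s *\<^sub>R e1 + sin s *\<^sub>R e2) \<and>
                        t = s rmod pi)"

definition angular_pushforward ::
    "(real^'n) measure \<Rightarrow> real^'n \<Rightarrow> real^'n \<Rightarrow> real measure" where
  "angular_pushforward \<mu> e1 e2 = distr \<mu> circle_mod_pi (plane_angle e1 e2)"

definition mutually_singular :: "'a measure \<Rightarrow> 'a measure \<Rightarrow> bool" where
  "mutually_singular M N \<longleftrightarrow>
     sets M = sets N \<and>
     (\<exists>A \<in> sets M. emeasure M A = 0 \<and> emeasure N (space N - A) = 0)"

section \<open>The functionals \<open>I\<^sub>\<mu>\<close> and \<open>g\<^sub>\<mu>\<close>\<close>

text \<open>
  In \<open>ennreal\<close> one has \<open>1 / 0 = \<infinity>\<close>, so the integrand of \<open>I_fun\<close> is infinite where \<open>a \<bullet> u = 0\<close>.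
\<close>

definition I_fun :: "(real^'n) measure \<Rightarrow> real^'n \<Rightarrow> ennreal" where
  "I_fun \<mu> u = (\<integral>\<^sup>+ a. 1 / ennreal \<bar>a \<bullet> u\<bar> \<partial>\<mu>)"

text \<open>
  The value of \<open>g_fun\<close> is meaningful only where \<open>I_fun \<mu> u < \<infinity>\<close>; there \<open>a \<bullet> u \<noteq> 0\<close> for almost
  every \<open>a\<close> and the Bochner integral converges absolutely.
\<close>

definition g_fun :: "(real^'n) measure \<Rightarrow> real^'n \<Rightarrow> real^'n" where
  "g_fun \<mu> u = (\<integral> a. (1 / (a \<bullet> u)) *\<^sub>R a \<partial>\<mu>)"

section \<open>Conditional laws\<close>

text \<open>
  The probability kernel \<open>\<kappa>\<close> is a version of the regular conditional law of the real random
  variable \<open>X\<close> given the \<open>N\<close>-valued random variable \<open>Y\<close>.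
\<close>

definition regular_cond_law ::
    "'w measure \<Rightarrow> ('w \<Rightarrow> real) \<Rightarrow> 'c measure \<Rightarrow> ('w \<Rightarrow> 'c) \<Rightarrow> ('c \<Rightarrow> real measure) \<Rightarrow> bool" where
  "regular_cond_law M X N Y \<kappa> \<longleftrightarrow>
     X \<in> borel_measurable M \<and> Y \<in> measurable M N \<and> \<kappa> \<in> measurable N (prob_algebra borel) \<and>
     (\<forall>B \<in> sets borel. AE \<omega> in M.
        real_cond_exp M (vimage_algebra (space M) Y N) (\<lambda>\<omega>'. indicator B (X \<omega>')) \<omega> =
        measure (\<kappa> (Y \<omega>)) B)"

definition cauchy_distribution :: "real \<Rightarrow> real \<Rightarrow> real measure" where
  "cauchy_distribution x0 \<gamma> =
     density lborel (\<lambda>x. ennreal (1 / (pi * \<gamma> * (1 + ((x - x0) / \<gamma>)\<^sup>2))))"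

end

theory Submission
  imports Defs "HOL-Complex_Analysis.Cauchy_Integral_Formula" "HOL-Real_Asymp.Real_Asymp"
begin

text \<open>
  Rotating a frame \<open>(u, v)\<close> inside its plane gives \<open>u\<^sub>\<theta> = cos \<theta> u + sin \<theta> v\<close> and
  \<open>v\<^sub>\<theta> = cos \<theta> v - sin \<theta> u\<close>, keeps the oriented plane, and preserves the law of a Haar frame.  If \<open>a\<close>
  has angle \<open>\<alpha>\<close> in the plane, then \<open>a \<bullet> u\<^sub>\<theta> = r cos (\<alpha> - \<theta>)\<close> and \<open>a \<bullet> v\<^sub>\<theta> = r sin (\<alpha> - \<theta>)\<close> with
  \<open>\<bar>r\<bar> \<le> 1\<close>, so that \<open>g\<^sub>\<mu> (u\<^sub>\<theta>) \<bullet> v\<^sub>\<theta>\<close> is the average of \<open>tan (\<alpha> - \<theta>)\<close> over the angular pushforward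
  \<open>\<nu>\<close> of \<open>\<mu>\<close>.  The whole proposition thereby becomes a statement about one probability measure \<open>\<nu>\<close>
  on \<open>\<real>/\<pi>\<int>\<close> and a uniformly distributed \<open>\<theta>\<close>, once it is known that the hypothesis on the sphere
  passes to almost every angle in almost every plane (\<open>haar_frame_good\<close>); this is Fubini together with
  the fact that the first vector of a Haar frame has the law \<open>\<sigma>\<close>.

  Cauchy law (\<open>tan_transform_cauchy\<close>).  The function \<open>F z = \<integral> (1 - z w) / (1 + z w) d\<nu>\<close> with
  \<open>w = exp (- 2 i \<alpha>)\<close> is holomorphic on the unit disc, has nonnegative real part, satisfies \<open>F 0 = 1\<close>, and
  its radial limit at \<open>exp (2 i \<theta>)\<close> is the purely imaginary number \<open>i X(\<theta>)\<close>, where \<open>X(\<theta>)\<close> is the average of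
  \<open>tan (\<alpha> - \<theta>)\<close>.  For \<open>t \<ge> 0\<close> the function \<open>exp (- t F)\<close> is bounded by \<open>1\<close>, so its mean value
  property survives the passage to the boundary and says \<open>E exp (- i t X) = exp (- t)\<close>: the
  characteristic function of \<open>X\<close> is \<open>exp (- \<bar>t\<bar>)\<close>, independently of \<open>\<nu>\<close>.  The case where \<open>\<nu>\<close> is a point mass
  identifies this as the characteristic function of the Cauchy law.

  Singularity (\<open>null_set_of_finite_potential\<close>).  At every \<open>x\<close> with \<open>\<integral> 1 / \<bar>t - x\<bar> d\<nu>(t) < \<infinity>\<close> the
  \<open>\<nu>\<close>-mass of an interval around \<open>x\<close> is negligible against its length, so by Vitali's covering lemma
  the set of all such \<open>x\<close> is \<open>\<nu>\<close>-null; by hypothesis it has full Lebesgue measure.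

  Conditional law (\<open>plane_and_field_independent\<close>).  Since a rotation by any angle preserves the law of the frame
  and the plane, averaging over \<open>\<theta>\<close> shows that the plane and \<open>g\<^sub>\<mu> (U) \<bullet> V\<close> are independent, the
  latter with the Cauchy law.  The constant Cauchy kernel is therefore a regular conditional law,
  and any other version agrees with it on all half-lines with rational end point, almost surely.
\<close>

section \<open>Haar measure on the orthogonal group and on the sphere\<close>

lemma haar_orthogonal_space: "haar_orthogonal H \<Longrightarrow> space H = {Q. orthogonal_matrix Q}"
  by (auto simp: haar_orthogonal_def space_restrict_space dest!: sets_eq_imp_space_eq)

lemma haar_orthogonal_sets:
  "haar_orthogonal H \<Longrightarrow> sets H = sets (restrict_space borel {Q. orthogonal_matrix Q})"
  by (simp add: haar_orthogonal_def)

lemma haar_orthogonal_prob: "haar_orthogonal H \<Longrightarrow> prob_space H"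
  by (simp add: haar_orthogonal_def)

lemma measurable_into_haar_orthogonal:
  assumes "haar_orthogonal H" "f \<in> borel_measurable N"
    "\<And>x. x \<in> space N \<Longrightarrow> orthogonal_matrix (f x)"
  shows "f \<in> measurable N H"
  using assms
  by (subst measurable_cong_sets[OF refl haar_orthogonal_sets[OF assms(1)]])
     (auto intro!: measurable_restrict_space2)

lemma measurable_from_haar_orthogonal:
  assumes "haar_orthogonal H" "f \<in> borel_measurable borel"
  shows "f \<in> borel_measurable H"
  using assms
  by (subst measurable_cong_sets[OF haar_orthogonal_sets[OF assms(1)] refl])
     (auto intro!: measurable_restrict_space1)

lemma continuous_matrix_mult: "continuous_on UNIV (\<lambda>(A :: real^'n^'n, B). A ** B)"
  unfolding matrix_matrix_mult_def case_prod_unfold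
  by (intro continuous_intros)

lemma measurable_haar_mult:
  assumes H: "haar_orthogonal H"
    and f: "f \<in> measurable N H" and g: "g \<in> measurable N H"
  shows "(\<lambda>x. f x ** g x) \<in> measurable N H"
proof (rule measurable_into_haar_orthogonal[OF H])
  have id: "(\<lambda>Q. Q) \<in> borel_measurable H"
    by (rule measurable_from_haar_orthogonal[OF H]) simp
  have "f \<in> borel_measurable N" "g \<in> borel_measurable N"
    using measurable_compose[OF f id] measurable_compose[OF g id] by simp_all
  then show "(\<lambda>x. f x ** g x) \<in> borel_measurable N"
    using borel_measurable_continuous_Pair[of f N g "\<lambda>A B. A ** B"] continuous_matrix_mult
    by (simp add: case_prod_unfold)
  show "orthogonal_matrix (f x ** g x)" if "x \<in> space N" for x
    using measurable_space[OF f that] measurable_space[OF g that] haar_orthogonal_space[OF H]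
    by (auto intro: orthogonal_matrix_mul)
qed

lemma measurable_haar_transpose:
  assumes H: "haar_orthogonal H" and f: "f \<in> measurable N H"
  shows "(\<lambda>x. transpose (f x)) \<in> measurable N H"
proof (rule measurable_into_haar_orthogonal[OF H])
  have "continuous_on UNIV (transpose :: real^'a^'a \<Rightarrow> real^'a^'a)"
    unfolding transpose_def by (intro continuous_intros)
  then have "transpose \<in> borel_measurable H"
    by (intro measurable_from_haar_orthogonal[OF H] borel_measurable_continuous_onI)
  with f show "(\<lambda>x. transpose (f x)) \<in> borel_measurable N"
    by (rule measurable_compose)
  show "orthogonal_matrix (transpose (f x))" if "x \<in> space N" for x
    using measurable_space[OF f that] haar_orthogonal_space[OF H]
    by auto
qed

lemma haar_left_invariant:
  assumes H: "haar_orthogonal H" and R: "orthogonal_matrix R" and f: "f \<in> borel_measurable H"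
  shows "(\<integral>\<^sup>+Q. f (R ** Q) \<partial>H) = (\<integral>\<^sup>+Q. f Q \<partial>H)"
proof -
  have "(\<lambda>Q. R ** Q) \<in> measurable H H"
    using R haar_orthogonal_space[OF H]
    by (intro measurable_haar_mult[OF H]) auto
  then have "(\<integral>\<^sup>+Q. f Q \<partial>distr H H (\<lambda>Q. R ** Q)) = (\<integral>\<^sup>+Q. f (R ** Q) \<partial>H)"
    by (rule nn_integral_distr) (use f in simp)
  moreover have "distr H H (\<lambda>Q. R ** Q) = H"
    using H R by (simp add: haar_orthogonal_def)
  ultimately show ?thesis by simp
qed

text \<open>
  Evaluate \<open>\<integral>\<integral> f (Q\<^sup>T Q') dQ dQ'\<close> in both orders.  Left invariance in \<open>Q'\<close> removes \<open>Q\<^sup>T\<close>; after writing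
  the argument as \<open>(Q'\<^sup>T Q)\<^sup>T\<close>, left invariance in \<open>Q\<close> removes \<open>Q'\<close>.
\<close>

lemma haar_transpose_invariant:
  assumes H: "haar_orthogonal H" and f [measurable]: "f \<in> borel_measurable H"
  shows "(\<integral>\<^sup>+Q. f (transpose Q) \<partial>H) = (\<integral>\<^sup>+Q. f Q \<partial>H)"
proof -
  interpret prob_space H using H by (rule haar_orthogonal_prob)
  interpret pair_sigma_finite H H ..
  note [measurable] = measurable_haar_mult[OF H] measurable_haar_transpose[OF H]
  have "(\<integral>\<^sup>+Q. f Q \<partial>H) = (\<integral>\<^sup>+Q. \<integral>\<^sup>+Q'. f Q' \<partial>H \<partial>H)"
    by (simp add: emeasure_space_1)
  also have "\<dots> = (\<integral>\<^sup>+Q. \<integral>\<^sup>+Q'. f (transpose Q ** Q') \<partial>H \<partial>H)"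
    by (intro nn_integral_cong haar_left_invariant[OF H, symmetric])
       (auto simp: haar_orthogonal_space[OF H])
  also have "\<dots> = (\<integral>\<^sup>+Q'. \<integral>\<^sup>+Q. f (transpose Q ** Q') \<partial>H \<partial>H)"
    by (intro Fubini') measurable
  also have "\<dots> = (\<integral>\<^sup>+Q'. \<integral>\<^sup>+Q. f (transpose (transpose Q' ** Q)) \<partial>H \<partial>H)"
    by (simp add: matrix_transpose_mul)
  also have "\<dots> = (\<integral>\<^sup>+Q'. \<integral>\<^sup>+Q. f (transpose Q) \<partial>H \<partial>H)"
    by (intro nn_integral_cong haar_left_invariant[OF H, where f = "\<lambda>Q. f (transpose Q)"])
       (auto simp: haar_orthogonal_space[OF H])
  also have "\<dots> = (\<integral>\<^sup>+Q. f (transpose Q) \<partial>H)"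
    by (simp add: emeasure_space_1)
  finally show ?thesis ..
qed

text \<open>
  Transposition exchanges the two sides, so left invariance gives right invariance.  It is
  needed because the columns of \<open>Q\<close> are rotated into each other by multiplying \<open>Q\<close> on the right.
\<close>

lemma haar_right_invariant:
  assumes H: "haar_orthogonal H" and R: "orthogonal_matrix R" and f [measurable]: "f \<in> borel_measurable H"
  shows "(\<integral>\<^sup>+Q. f (Q ** R) \<partial>H) = (\<integral>\<^sup>+Q. f Q \<partial>H)"
proof -
  note [measurable] = measurable_haar_mult[OF H] measurable_haar_transpose[OF H]
  have [measurable]: "(\<lambda>_. R) \<in> measurable N H" for N
    using R by (intro measurable_const) (simp add: haar_orthogonal_space[OF H])
  have "(\<integral>\<^sup>+Q. f (Q ** R) \<partial>H) = (\<integral>\<^sup>+Q. f (transpose Q ** R) \<partial>H)"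
    by (rule haar_transpose_invariant[OF H, symmetric]) measurable
  also have "\<dots> = (\<integral>\<^sup>+Q. f (transpose (transpose R ** Q)) \<partial>H)"
    by (simp add: matrix_transpose_mul)
  also have "\<dots> = (\<integral>\<^sup>+Q. f (transpose Q) \<partial>H)"
    using R by (intro haar_left_invariant[OF H]) auto
  also have "\<dots> = (\<integral>\<^sup>+Q. f Q \<partial>H)"
    by (rule haar_transpose_invariant[OF H]) fact
  finally show ?thesis .
qed

lemma continuous_on_column: "continuous_on S (column i :: real^'n^'m \<Rightarrow> real^'m)"
  unfolding column_def by (intro continuous_intros)

lemma continuous_on_matrix_vector:
  "continuous_on UNIV (\<lambda>(A :: real^'n^'m, x). A *v x)"
  unfolding matrix_vector_mult_def case_prod_unfold by (intro continuous_intros)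

lemma borel_measurable_matrix_vector:
  assumes "A \<in> borel_measurable N" "y \<in> borel_measurable N"
  shows "(\<lambda>x. A x *v (y x :: real^'n) :: real^'m) \<in> borel_measurable N"
  using borel_measurable_continuous_Pair[OF assms, of "\<lambda>A y. A *v y"] continuous_on_matrix_vector
  by (simp add: case_prod_unfold)

lemma haar_sphere_space: "haar_sphere \<sigma> \<Longrightarrow> space \<sigma> = sphere 0 1"
  by (auto simp: haar_sphere_def space_restrict_space dest!: sets_eq_imp_space_eq)

lemma measurable_from_haar_sphere:
  assumes "haar_sphere \<sigma>" "g \<in> borel_measurable borel"
  shows "g \<in> borel_measurable \<sigma>"
proof -
  have "sets \<sigma> = sets (restrict_space borel (sphere 0 1))" 
    using assms(1) by (simp add: haar_sphere_def)
  from measurable_cong_sets[OF this refl] measurable_restrict_space1[OF assms(2)]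
  show ?thesis by blast
qed

lemma measurable_into_haar_sphere:
  assumes "haar_sphere \<sigma>" "g \<in> borel_measurable N" "\<And>x. x \<in> space N \<Longrightarrow> norm (g x) = 1"
  shows "g \<in> measurable N \<sigma>"
proof -
  have "sets \<sigma> = sets (restrict_space borel (sphere 0 1))" 
    using assms(1) by (simp add: haar_sphere_def)
  moreover have "g \<in> measurable N (restrict_space borel (sphere 0 1))"
    using assms by (intro measurable_restrict_space2) auto
  ultimately show ?thesis using measurable_cong_sets by blast
qed

lemma haar_sphere_rotate:
  assumes \<sigma>: "haar_sphere \<sigma>" and Q: "orthogonal_matrix Q" and f: "f \<in> borel_measurable borel"
  shows "(\<integral>\<^sup>+u. f (Q *v u) \<partial>\<sigma>) = (\<integral>\<^sup>+u. f u \<partial>\<sigma>)"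
proof -
  have norm_Q: "norm (Q *v u) = norm u" for u
    using Q orthogonal_transformation_matrix[of "\<lambda>x. Q *v x"]
    by (auto simp: orthogonal_transformation)
  have "(\<lambda>u. Q *v u) \<in> borel_measurable \<sigma>"
    by (intro measurable_from_haar_sphere[OF \<sigma>] borel_measurable_matrix_vector) auto
  then have "(\<lambda>u. Q *v u) \<in> measurable \<sigma> \<sigma>"
    by (rule measurable_into_haar_sphere[OF \<sigma>]) (simp add: norm_Q haar_sphere_space[OF \<sigma>])
  then have "(\<integral>\<^sup>+u. f u \<partial>distr \<sigma> \<sigma> (\<lambda>u. Q *v u)) = (\<integral>\<^sup>+u. f (Q *v u) \<partial>\<sigma>)"
    by (rule nn_integral_distr) (simp add: measurable_from_haar_sphere[OF \<sigma> f])
  moreover have "distr \<sigma> \<sigma> (\<lambda>u. Q *v u) = \<sigma>" using \<sigma> Q by (simp add: haar_sphere_def)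
  ultimately show ?thesis by simp
qed

text \<open>
  Uniqueness of the invariant law on the sphere, in the form in which it is used: average
  \<open>\<integral> f (Q u) d\<sigma>(u)\<close> over \<open>Q\<close>.  For fixed \<open>u = R e\<^sub>i\<close> the inner average over \<open>Q\<close> is that of \<open>f\<close> at the
  \<open>i\<close>-th column of \<open>Q R\<close>, and \<open>R\<close> disappears by right invariance.
\<close>

lemma haar_sphere_eq_column_law:
  assumes H: "haar_orthogonal H" and \<sigma>: "haar_sphere \<sigma>"
    and f: "f \<in> borel_measurable borel"
  shows "(\<integral>\<^sup>+u. f u \<partial>\<sigma>) = (\<integral>\<^sup>+Q. f (column i Q) \<partial>H)"
proof -
  interpret H: prob_space H using H by (rule haar_orthogonal_prob)
  interpret S: prob_space \<sigma> using \<sigma> by (simp add: haar_sphere_def)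
  interpret pair_sigma_finite H \<sigma> ..
  have idH: "(\<lambda>Q. Q) \<in> borel_measurable H"
    by (rule measurable_from_haar_orthogonal[OF H]) simp
  have id\<sigma>: "(\<lambda>u. u) \<in> borel_measurable \<sigma>"
    by (rule measurable_from_haar_sphere[OF \<sigma>]) simp
  have joint: "(\<lambda>(Q, u). f (Q *v u)) \<in> borel_measurable (H \<Otimes>\<^sub>M \<sigma>)"
    unfolding case_prod_unfold
    by (intro measurable_compose[OF borel_measurable_matrix_vector f]
          measurable_compose[OF measurable_fst idH] measurable_compose[OF measurable_snd id\<sigma>])
  have "(\<integral>\<^sup>+u. f u \<partial>\<sigma>) = (\<integral>\<^sup>+Q. \<integral>\<^sup>+u. f u \<partial>\<sigma> \<partial>H)"
    by (simp add: H.emeasure_space_1)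
  also have "\<dots> = (\<integral>\<^sup>+Q. \<integral>\<^sup>+u. f (Q *v u) \<partial>\<sigma> \<partial>H)"
    using haar_orthogonal_space[OF H]
    by (intro nn_integral_cong haar_sphere_rotate[OF \<sigma> _ f, symmetric]) auto
  also have "\<dots> = (\<integral>\<^sup>+u. \<integral>\<^sup>+Q. f (Q *v u) \<partial>H \<partial>\<sigma>)"
    using joint by (rule Fubini'[symmetric])
  also have "\<dots> = (\<integral>\<^sup>+u. \<integral>\<^sup>+Q. f (column i Q) \<partial>H \<partial>\<sigma>)"
  proof (rule nn_integral_cong)
    fix u assume "u \<in> space \<sigma>"
    then have "norm u = 1" by (simp add: haar_sphere_space[OF \<sigma>])
    then obtain R where R: "orthogonal_matrix R" "R *v axis i 1 = u"
      using orthogonal_matrix_exists_basis by metis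
    have "(\<integral>\<^sup>+Q. f (Q *v u) \<partial>H) = (\<integral>\<^sup>+Q. f ((Q ** R) *v axis i 1) \<partial>H)"
      by (simp add: R(2)[symmetric] matrix_vector_mul_assoc)
    also have "\<dots> = (\<integral>\<^sup>+Q. f (Q *v axis i 1) \<partial>H)"
      by (rule haar_right_invariant[OF H R(1)])
         (intro measurable_compose[OF borel_measurable_matrix_vector f] idH measurable_const, simp)
    finally show "(\<integral>\<^sup>+Q. f (Q *v u) \<partial>H) = (\<integral>\<^sup>+Q. f (column i Q) \<partial>H)"
      by (simp add: matrix_vector_mult_basis)
  qed
  also have "\<dots> = (\<integral>\<^sup>+Q. f (column i Q) \<partial>H)"
    by (simp add: S.emeasure_space_1)
  finally show ?thesis .
qed

section \<open>Points of finite potential form a null set\<close>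

text \<open>
  On the ball of radius \<open>5 r\<close> around \<open>x\<close> the kernel \<open>1 / \<bar>t - x\<bar>\<close> is at least \<open>1 / (5 r)\<close>, and the
  integral of the kernel over that ball tends to \<open>0\<close> with \<open>r\<close>, because the point \<open>x\<close> carries no mass.  The
  factor \<open>5\<close> is the one of the covering lemma.
\<close>

lemma small_balls_of_finite_potential:
  fixes N :: "real measure"
  assumes sets_N [measurable_cong]: "sets N = sets borel"
    and fin: "(\<integral>\<^sup>+t. 1 / ennreal \<bar>t - x\<bar> \<partial>N) < \<infinity>" and "\<epsilon> > 0"
  obtains r where "0 < r" "r \<le> 1" "emeasure N (cball x (5 * r)) \<le> ennreal (\<epsilon> * r)"
proof -
  \<comment> \<open>A finite measure; its mass on small balls tends to \<open>D {x} = 0\<close>.\<close>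
  define D where "D = density N (\<lambda>t. 1 / ennreal \<bar>t - x\<bar>)"
  define B where "B = (\<lambda>n::nat. cball x (5 / real (Suc n)))"
  have B_sets [measurable]: "B n \<in> sets borel" for n by (simp add: B_def)
  have sets_D: "sets D = sets borel"
    by (simp add: D_def sets_N)
  have finD: "emeasure D X < \<infinity>" if "X \<in> sets borel" for X
  proof -
    have "emeasure D X \<le> emeasure D (space D)"
      using that sets_D by (intro emeasure_space)
    also have "\<dots> = (\<integral>\<^sup>+t. 1 / ennreal \<bar>t - x\<bar> \<partial>N)"
      by (simp add: D_def emeasure_density cong: nn_integral_cong)
    finally show ?thesis using fin by simp
  qed
  have "AE t in N. 1 / ennreal \<bar>t - x\<bar> \<noteq> \<infinity>"
    using fin by (intro nn_integral_noteq_infinite) (auto simp: less_top)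
  then have "AE t in N. t \<noteq> x"
    by eventually_elim (auto simp: ennreal_divide_zero)
  then have "emeasure N {t \<in> space N. t = x} = 0"
    by (rule emeasure_eq_0_AE)
  then have "{x} \<in> null_sets N"
    using sets_eq_imp_space_eq[OF sets_N] by (auto simp: null_sets_def sets_N)
  then have "emeasure D {x} = 0"
    unfolding D_def by (subst emeasure_density) (auto simp: sets_N nn_integral_null_set)
  moreover have "(\<Inter>n. B n) = {x}"
  proof (intro equalityI subsetI)
    fix t assume t: "t \<in> (\<Inter>n. B n)"
    show "t \<in> {x}"
    proof (rule ccontr)
      assume "t \<notin> {x}"
      then have "\<bar>t - x\<bar> / 5 > 0" by simp
      then obtain n where "inverse (real (Suc n)) < \<bar>t - x\<bar> / 5"
        using reals_Archimedean by blast
      then have "5 / real (Suc n) < dist x t"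
        by (simp add: field_simps dist_real_def abs_minus_commute)
      moreover have "dist x t \<le> 5 / real (Suc n)"
        using t by (auto simp: B_def simp del: of_nat_Suc)
      ultimately show False by linarith
    qed
  qed (auto simp: B_def)
  moreover have "(\<lambda>n. emeasure D (B n)) \<longlonglongrightarrow> emeasure D (\<Inter>n. B n)"
  proof (rule Lim_emeasure_decseq)
    show "decseq B"
      unfolding B_def by (intro decseq_SucI subset_cball) (simp add: field_simps)
    show "range B \<subseteq> sets D" by (auto simp: sets_D B_def)
    show "emeasure D (B n) \<noteq> \<infinity>" for n
      using finD[of "B n"] by (auto simp: B_def)
  qed
  ultimately have "(\<lambda>n. emeasure D (B n)) \<longlonglongrightarrow> 0" by simp
  from order_tendstoD(2)[OF this, of "ennreal (\<epsilon> / 5)"] \<open>\<epsilon> > 0\<close>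
  obtain n where n: "emeasure D (B n) < ennreal (\<epsilon> / 5)"
    by (auto simp: eventually_sequentially)
  define r where "r = 1 / real (Suc n)"
  have r: "0 < r" "r \<le> 1" by (auto simp: r_def)
  have "emeasure N (cball x (5 * r)) = (\<integral>\<^sup>+t. indicator (B n) t \<partial>N)"
    by (simp add: B_def r_def sets_N)
  also have "\<dots> \<le> (\<integral>\<^sup>+t. ennreal (5 * r) * (1 / ennreal \<bar>t - x\<bar> * indicator (B n) t) \<partial>N)"
  proof (rule nn_integral_mono)
    fix t
    show "indicator (B n) t \<le> ennreal (5 * r) * (1 / ennreal \<bar>t - x\<bar> * indicator (B n) t)"
    proof (cases "t \<in> B n")
      case True
      then have le: "\<bar>t - x\<bar> \<le> 5 * r" by (simp add: B_def r_def dist_real_def abs_minus_commute)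
      show ?thesis
      proof (cases "t = x")
        case True
        then show ?thesis using \<open>t \<in> B n\<close> r by (simp add: ennreal_divide_zero ennreal_mult_top)
      next
        case False
        then have "1 \<le> 5 * r * (1 / \<bar>t - x\<bar>)" using le by (simp add: field_simps)
        then have "ennreal 1 \<le> ennreal (5 * r) * ennreal (1 / \<bar>t - x\<bar>)"
          using r by (subst ennreal_mult[symmetric]) (auto intro: ennreal_leI)
        moreover have "ennreal (1 / \<bar>t - x\<bar>) = 1 / ennreal \<bar>t - x\<bar>"
          using False by (subst divide_ennreal[symmetric]) auto
        ultimately show ?thesis using True by simp
      qed
    qed auto
  qed
  also have "\<dots> = ennreal (5 * r) * emeasure D (B n)"
    unfolding D_def by (subst emeasure_density) (auto simp: sets_N intro!: nn_integral_cmult)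
  also have "\<dots> \<le> ennreal (5 * r) * ennreal (\<epsilon> / 5)"
    using n by (intro mult_left_mono) auto
  also have "\<dots> = ennreal (\<epsilon> * r)"
    using r \<open>\<epsilon> > 0\<close> by (subst ennreal_mult[symmetric]) (auto simp: mult_ac)
  finally show ?thesis using r that by blast
qed

text \<open>
  Cover \<open>A\<close> by the enlargements of countably many disjoint intervals whose mass, even after
  enlargement, is at most \<open>\<delta>\<close> times their length.  The intervals lie in a fixed bounded interval, so
  the total mass is at most a constant times \<open>\<delta>\<close>.
\<close>

lemma null_set_of_finite_potential:
  fixes N :: "real measure"
  assumes sets_N [measurable_cong]: "sets N = sets borel"
    and A [measurable]: "A \<in> sets borel" "bounded A"
    and fin: "\<And>x. x \<in> A \<Longrightarrow> (\<integral>\<^sup>+t. 1 / ennreal \<bar>t - x\<bar> \<partial>N) < \<infinity>"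
  shows "emeasure N A = 0"
proof -
  obtain b where b: "b > 0" "\<And>x. x \<in> A \<Longrightarrow> \<bar>x\<bar> \<le> b"
    using A(2) by (auto simp: bounded_pos)
  have bound: "emeasure N A \<le> ennreal \<epsilon>" if "\<epsilon> > 0" for \<epsilon> :: real
  proof -
    \<comment> \<open>The disjoint intervals lie in \<open>{- (b + 1)..b + 1}\<close>, and an interval of radius \<open>r\<close> has length \<open>2 r\<close>.\<close>
    define \<delta> where "\<delta> = \<epsilon> / (b + 1)"
    have \<delta>: "\<delta> > 0" using that b by (simp add: \<delta>_def)
    have "\<forall>x\<in>A. \<exists>r. 0 < r \<and> r \<le> 1 \<and> emeasure N (cball x (5 * r)) \<le> ennreal (\<delta> * r)"
      using small_balls_of_finite_potential[OF sets_N fin \<delta>] by metis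
    then obtain r where r: "\<And>x. x \<in> A \<Longrightarrow> 0 < r x \<and> r x \<le> 1"
        "\<And>x. x \<in> A \<Longrightarrow> emeasure N (cball x (5 * r x)) \<le> ennreal (\<delta> * r x)"
      by metis
    obtain C where C: "countable C" "C \<subseteq> A"
      "pairwise (\<lambda>i j. disjnt (cball i (r i)) (cball j (r j))) C"
      "A \<subseteq> (\<Union>i\<in>C. cball i (5 * r i))"
    proof (rule Vitali_covering_lemma_cballs[where S = A and K = A and a = "\<lambda>x. x" and r = r and B = 1])
      show "A \<subseteq> (\<Union>i\<in>A. cball i (r i))" using r(1) by (force intro: less_imp_le)
    qed (use r in auto)
    have "emeasure N A = (\<integral>\<^sup>+t. indicator A t \<partial>N)" by (simp add: sets_N)
    also have "\<dots> \<le> (\<integral>\<^sup>+t. (\<integral>\<^sup>+i. indicator (cball i (5 * r i)) t \<partial>count_space C) \<partial>N)"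
    proof (rule nn_integral_mono)
      fix t
      show "indicator A t \<le> (\<integral>\<^sup>+i. indicator (cball i (5 * r i)) t \<partial>count_space C)"
      proof (cases "t \<in> A")
        case True
        then obtain i where i: "i \<in> C" "t \<in> cball i (5 * r i)" using C(4) by blast
        have "indicator (cball i (5 * r i)) t \<le> (\<integral>\<^sup>+i. indicator (cball i (5 * r i)) t \<partial>count_space C)"
          using i(1) by (rule nn_integral_ge_point)
        with i True show ?thesis by simp
      qed auto
    qed
    also have "\<dots> = (\<integral>\<^sup>+i. (\<integral>\<^sup>+t. indicator (cball i (5 * r i)) t \<partial>N) \<partial>count_space C)"
      by (rule nn_integral_count_space_nn_integral) (auto simp: C sets_N intro!: borel_measurable_indicator)
    also have "\<dots> \<le> (\<integral>\<^sup>+i. ennreal (\<delta> / 2) * emeasure lborel (cball i (r i)) \<partial>count_space C)"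
    proof (rule nn_integral_mono)
      fix i assume "i \<in> space (count_space C)"
      then have i: "i \<in> A" using C by auto
      have "(\<integral>\<^sup>+t. indicator (cball i (5 * r i)) t \<partial>N) \<le> ennreal (\<delta> * r i)"
        using r(2)[OF i] by (simp add: sets_N)
      also have "\<dots> = ennreal (\<delta> / 2) * emeasure lborel (cball i (r i))"
        using r(1)[OF i] \<delta> by (simp add: cball_eq_atLeastAtMost ennreal_mult[symmetric])
      finally show "(\<integral>\<^sup>+t. indicator (cball i (5 * r i)) t \<partial>N) \<le> \<dots>" .
    qed
    also have "\<dots> = ennreal (\<delta> / 2) * emeasure lborel (\<Union>i\<in>C. cball i (r i))"
      using C by (subst emeasure_UN_countable)
        (auto simp: nn_integral_cmult disjoint_family_on_def pairwise_def disjnt_def)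
    also have "\<dots> \<le> ennreal (\<delta> / 2) * emeasure lborel {- (b + 1)..b + 1}"
    proof (intro mult_left_mono emeasure_mono)
      show "(\<Union>i\<in>C. cball i (r i)) \<subseteq> {- (b + 1)..b + 1}"
        using b(2) r(1) C(2) by (fastforce simp: cball_eq_atLeastAtMost)
    qed auto
    also have "\<dots> = ennreal \<epsilon>"
    proof -
      define c where "c = 2 * (b + 1)"
      have "emeasure lborel {- (b + 1)..b + 1} = ennreal c"
        using b by (simp add: c_def algebra_simps)
      moreover have "\<delta> / 2 * c = \<epsilon>" "c \<ge> 0" using b by (auto simp: \<delta>_def c_def field_simps)
      ultimately show ?thesis
        using \<delta> by (simp add: ennreal_mult[symmetric])
    qed
    finally show ?thesis .
  qed
  show ?thesis
  proof (rule ccontr)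
    assume "emeasure N A \<noteq> 0"
    have "emeasure N A \<noteq> \<infinity>" using bound[of 1] by (auto simp: top_unique)
    then obtain m where m: "emeasure N A = ennreal m" "m \<ge> 0"
      by (cases "emeasure N A") auto
    with \<open>emeasure N A \<noteq> 0\<close> have "m > 0" by (cases "m = 0") auto
    with bound[of "m / 2"] m show False by (simp add: ennreal_le_iff)
  qed
qed

section \<open>The law of an averaged tangent\<close>

lemma one_divide_ennreal: "r > 0 \<Longrightarrow> 1 / ennreal r = ennreal (1 / r)"
  by (subst ennreal_1[symmetric], subst divide_ennreal) auto

text \<open>
  The angle of rotation will be \<open>\<pi> s\<close> with \<open>s\<close> uniform on \<open>[0, 1]\<close>.  Half a turn is enough: the
  circle is then covered once by \<open>exp (2 i \<pi> s)\<close>, which is the boundary variable of the disc.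
\<close>

definition unif01 :: "real measure" where
  "unif01 = uniform_measure lborel {0..1}"

lemma prob_space_unif01: "prob_space unif01"
  unfolding unif01_def by (rule prob_space_uniform_measure) auto

lemma sets_unif01 [measurable_cong, simp]: "sets unif01 = sets borel"
  by (simp add: unif01_def)

lemma space_unif01 [simp]: "space unif01 = UNIV"
  by (simp add: unif01_def)

lemma AE_unif01:
  assumes "AE s in lborel. P s" shows "AE s in unif01. P s"
  unfolding unif01_def by (rule AE_uniform_measureI) (use assms in auto)

lemma integral_unif01:
  fixes f :: "real \<Rightarrow> complex"
  assumes f: "continuous_on UNIV f"
  shows "(\<integral>s. f s \<partial>unif01) = integral {0..1} f"
proof -
  have [measurable]: "f \<in> borel_measurable borel"
    using f by (rule borel_measurable_continuous_onI)
  have "unif01 = density lborel (\<lambda>s. ennreal (indicator {0..1} s))"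
    by (simp add: unif01_def uniform_measure_def divide_ennreal_def ennreal_indicator)
  then have "(\<integral>s. f s \<partial>unif01) = (\<integral>s. f s \<partial>density lborel (\<lambda>s. ennreal (indicator {0..1} s)))"
    by simp
  also have "\<dots> = (\<integral>s. indicator {0..1} s *\<^sub>R f s \<partial>lborel)"
    by (rule integral_density) auto
  also have "\<dots> = integral {0..1} f"
    using set_borel_integral_eq_integral(2)[OF borel_integrable_atLeastAtMost'[of 0 1 f]]
      continuous_on_subset[OF f]
    by (simp add: set_lebesgue_integral_def)
  finally show ?thesis .
qed

text \<open>
  Cauchy's integral formula at the centre of the circle of radius \<open>r\<close>.
\<close>

lemma mean_value_unif01:
  assumes f: "f holomorphic_on ball 0 1" and r: "0 < r" "r < 1"
  shows "(\<integral>s. f (of_real r * cis (2 * pi * s)) \<partial>unif01) = f 0"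
proof -
  have sub: "cball 0 r \<subseteq> ball (0::complex) 1" using r by auto
  have cont: "continuous_on UNIV (\<lambda>s. f (of_real r * cis (2 * pi * s)))"
  proof (rule continuous_on_compose2[OF holomorphic_on_imp_continuous_on[OF f]])
    show "continuous_on UNIV (\<lambda>s. of_real r * cis (2 * pi * s))"
      by (intro continuous_intros)
  qed (use r in \<open>auto simp: norm_mult\<close>)
  have "((\<lambda>u. f u / (u - 0)) has_contour_integral (2 * of_real pi * \<i> * f 0)) (circlepath 0 r)"
    using r sub by (intro Cauchy_integral_circlepath_simple holomorphic_on_subset[OF f]) auto
  then have "((\<lambda>s. f (of_real r * cis (2 * pi * s)) * (2 * of_real pi * \<i>)) has_integral (2 * of_real pi * \<i> * f 0)) {0..1}"
    unfolding has_contour_integral_def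
  proof (elim has_integral_eq[rotated])
    fix s :: real assume s: "s \<in> {0..1}"
    have e: "exp (2 * of_real pi * \<i> * of_real s) = cis (2 * pi * s)"
      by (simp add: cis_conv_exp mult_ac)
    have d: "vector_derivative (circlepath 0 r) (at s within {0..1}) = 2 * pi * \<i> * r * cis (2 * pi * s)"
      using s by (subst vector_derivative_circlepath01) (auto simp: e)
    have c: "circlepath 0 r s = of_real r * cis (2 * pi * s)"
      by (simp add: circlepath e)
    show "f (circlepath 0 r s) / (circlepath 0 r s - 0) * vector_derivative (circlepath 0 r) (at s within {0..1}) =
        f (of_real r * cis (2 * pi * s)) * (2 * of_real pi * \<i>)"
      unfolding d c using r by simp
  qed
  from has_integral_mult_left[OF this, of "1 / (2 * of_real pi * \<i>)"]
  have "((\<lambda>s. f (of_real r * cis (2 * pi * s))) has_integral f 0) {0..1}"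
    by simp
  then show ?thesis
    using integral_unif01[OF cont] by (simp add: integral_unique)
qed

text \<open>
  The map \<open>w \<mapsto> (1 - w) / (1 + w) = 2 / (1 + w) - 1\<close> sends the unit disc to the right half-plane.
  The second form has the variable in only one place, which simplifies expansions and bounds.
\<close>

lemma Re_cayley_nonneg:
  assumes "norm w < 1" shows "0 \<le> Re (2 / (1 + w) - 1)"
proof -
  have ne: "1 + w \<noteq> 0" using assms by (metis add_eq_0_iff norm_minus_cancel norm_one order_less_irrefl)
  have "(norm w)\<^sup>2 \<le> 1" using assms by (simp add: power_le_one)
  then have "(1 + Re w)\<^sup>2 + (Im w)\<^sup>2 \<le> 2 * (1 + Re w)"
    unfolding cmod_power2 by (simp add: power2_eq_square algebra_simps)
  moreover have "(1 + Re w)\<^sup>2 + (Im w)\<^sup>2 > 0"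
    using ne by (simp add: complex_eq_iff sum_power2_gt_zero_iff)
  ultimately show ?thesis by (simp add: Re_divide field_simps)
qed

lemma one_plus_cis_double: "1 + cis (2 * \<phi>) = 2 * of_real (cos \<phi>) * cis \<phi>"
  by (simp add: complex_eq_iff cos_double_cos sin_double power2_eq_square)

text \<open>
  The same map sends the unit circle to the imaginary axis.
\<close>

lemma cayley_cis: "cos \<phi> \<noteq> 0 \<Longrightarrow> 2 / (1 + cis (2 * \<phi>)) - 1 = - \<i> * of_real (tan \<phi>)"
proof -
  assume c: "cos \<phi> \<noteq> 0"
  have "2 / (1 + cis (2 * \<phi>)) = cis (- \<phi>) / of_real (cos \<phi>)"
    unfolding one_plus_cis_double using c by (simp add: field_simps cis_mult)
  also have "\<dots> = 1 - \<i> * of_real (tan \<phi>)"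
    using c by (simp add: complex_eq_iff tan_def Re_divide_of_real Im_divide_of_real)
  finally show ?thesis by simp
qed

lemma norm_one_plus_cis_double: "norm (1 + cis (2 * \<phi>)) = 2 * \<bar>cos \<phi>\<bar>"
proof -
  show ?thesis unfolding one_plus_cis_double by (simp add: norm_mult)
qed

text \<open>
  A bound by the boundary value that is uniform in the radius.  It provides the integrable
  majorant for radial limits.  It holds because \<open>\<bar>1 + w\<bar> \<le> \<bar>1 + r w\<bar> + (1 - r)\<close> and
  \<open>1 - r \<le> \<bar>1 + r w\<bar>\<close>.
\<close>

lemma norm_one_plus_radial:
  fixes w :: complex
  assumes "norm w = 1" "0 \<le> r" "r \<le> 1"
  shows "norm (1 + w) \<le> 2 * norm (1 + of_real r * w)"
proof -
  have "norm (1 + w) \<le> norm (1 + of_real r * w) + norm (of_real (1 - r) * w)"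
    by (rule order_trans[OF _ norm_triangle_ineq]) (simp add: algebra_simps)
  also have "norm (of_real (1 - r) * w) = 1 - r" using assms by (simp add: norm_mult del: of_real_diff)
  also have "1 - r \<le> norm (1 + of_real r * w)"
    using norm_triangle_ineq2[of 1 "- (of_real r * w)"] assms by (simp add: norm_mult)
  finally show ?thesis by simp
qed

context
  fixes N :: "'a measure" and \<alpha> :: "'a \<Rightarrow> real"
  assumes N: "prob_space N" and \<alpha> [measurable]: "\<alpha> \<in> borel_measurable N"
begin

interpretation prob_space N by (rule N)

text \<open>
  The Herglotz integral of the law of \<open>\<zeta> = - exp (2 i \<alpha>)\<close>: the kernel \<open>(\<zeta> + z) / (\<zeta> - z)\<close> equals
  \<open>(1 - z w) / (1 + z w)\<close> with \<open>w = exp (- 2 i \<alpha>)\<close>.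
\<close>

definition herglotz :: "complex \<Rightarrow> complex" where
  "herglotz z = (\<integral>x. (2 / (1 + z * cis (- 2 * \<alpha> x)) - 1) \<partial>N)"

lemma measurable_cis_angle [measurable]: "(\<lambda>x. cis (- 2 * \<alpha> x)) \<in> borel_measurable N"
proof -
  have "cis \<in> borel_measurable borel" 
    by (intro borel_measurable_continuous_onI continuous_intros)
  then show ?thesis by measurable
qed

lemma disc_nonzero: "norm z < 1 \<Longrightarrow> 1 + z * cis t \<noteq> 0"
proof
  assume z: "norm z < 1" and "1 + z * cis t = 0"
  then have "z * cis t = - 1" by (simp add: add_eq_0_iff)
  then have "norm (z * cis t) = 1" by simp
  with z show False by (simp add: norm_mult)
qed

lemma herglotz_integrable:
  assumes z: "norm z < 1"
  shows "integrable N (\<lambda>x. 2 / (1 + z * cis (- 2 * \<alpha> x)))"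
proof (rule integrable_const_bound)
  have "1 - norm z \<le> norm (1 + z * cis t)" for t
    using norm_triangle_ineq2[of 1 "- (z * cis t)"] by (simp add: norm_mult)
  then show "AE x in N. norm (2 / (1 + z * cis (- 2 * \<alpha> x))) \<le> 2 / (1 - norm z)"
    using z by (intro AE_I2) (auto simp: norm_divide intro!: divide_left_mono mult_pos_pos disc_nonzero)
qed measurable

text \<open>
  Expand \<open>1 / (1 + z w)\<close> in a geometric series and integrate term by term.
\<close>

lemma herglotz_holomorphic: "herglotz holomorphic_on ball 0 1"
proof -
  have sums: "(\<lambda>n. (\<integral>x. (- cis (- 2 * \<alpha> x)) ^ n \<partial>N) * (z - 0) ^ n) sums (\<integral>x. 1 / (1 + z * cis (- 2 * \<alpha> x)) \<partial>N)"
    if z: "z \<in> ball 0 1" for z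
  proof -
    have z': "norm z < 1" using z by simp
    have s: "(\<lambda>n. \<integral>x. (- z * cis (- 2 * \<alpha> x)) ^ n \<partial>N) sums (\<integral>x. (\<Sum>n. (- z * cis (- 2 * \<alpha> x)) ^ n) \<partial>N)"
    proof (rule sums_integral)
      show "integrable N (\<lambda>x. (- z * cis (- 2 * \<alpha> x)) ^ n)" for n
      proof (rule integrable_const_bound)
        show "AE x in N. norm ((- z * cis (- 2 * \<alpha> x)) ^ n) \<le> 1"
          using z' by (auto simp: norm_power norm_mult power_le_one)
      qed measurable
      show "AE x in N. summable (\<lambda>n. norm ((- z * cis (- 2 * \<alpha> x)) ^ n))"
        using z' by (simp add: norm_power norm_mult summable_geometric)
      show "summable (\<lambda>n. \<integral>x. norm ((- z * cis (- 2 * \<alpha> x)) ^ n) \<partial>N)"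
        using z' by (simp add: norm_power norm_mult summable_geometric prob_space)
    qed
    have "(\<Sum>n. (- z * cis t) ^ n) = 1 / (1 + z * cis t)" for t
      using suminf_geometric[of "- z * cis t"] z' by (simp add: norm_mult)
    moreover have "(\<integral>x. (- z * cis (- 2 * \<alpha> x)) ^ n \<partial>N) = (\<integral>x. (- cis (- 2 * \<alpha> x)) ^ n \<partial>N) * (z - 0) ^ n" for n
    proof -
      have "(- z * cis (- 2 * \<alpha> x)) ^ n = (- cis (- 2 * \<alpha> x)) ^ n * z ^ n" for x
        by (simp flip: power_mult_distrib add: mult_ac)
      then show ?thesis by simp
    qed
    ultimately show ?thesis using s by simp
  qed
  have "(\<lambda>z. 2 * (\<integral>x. 1 / (1 + z * cis (- 2 * \<alpha> x)) \<partial>N) - 1) holomorphic_on ball 0 1"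
    by (intro holomorphic_intros power_series_holomorphic[OF sums])
  then show ?thesis
  proof (rule holomorphic_transform)
    fix z :: complex assume "z \<in> ball 0 1"
    then have "norm z < 1" by simp
    note int = herglotz_integrable[OF this]
    have "(\<integral>x. 2 / (1 + z * cis (- 2 * \<alpha> x)) \<partial>N) = 2 * (\<integral>x. 1 / (1 + z * cis (- 2 * \<alpha> x)) \<partial>N)"
      by (subst integral_mult_right_zero[symmetric]) simp
    then show "2 * (\<integral>x. 1 / (1 + z * cis (- 2 * \<alpha> x)) \<partial>N) - 1 = herglotz z"
      unfolding herglotz_def using int by (simp add: prob_space)
  qed
qed

lemma Re_herglotz_nonneg:
  assumes z: "norm z < 1" shows "0 \<le> Re (herglotz z)"
proof -
  have int: "integrable N (\<lambda>x. 2 / (1 + z * cis (- 2 * \<alpha> x)) - 1)"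
    using herglotz_integrable[OF z] by simp
  have "Re (herglotz z) = (\<integral>x. Re (2 / (1 + z * cis (- 2 * \<alpha> x)) - 1) \<partial>N)"
    unfolding herglotz_def by (rule integral_Re[OF int, symmetric])
  also have "\<dots> \<ge> 0"
    using z by (intro integral_nonneg_AE AE_I2 Re_cayley_nonneg) (simp add: norm_mult)
  finally show ?thesis .
qed

lemma herglotz_0: "herglotz 0 = 1"
  by (simp add: herglotz_def prob_space)

text \<open>
  Dominated convergence.  By \<open>norm_one_plus_radial\<close> the integrands are bounded by
  \<open>2 / \<bar>cos (\<alpha> - \<theta>)\<bar> + 1\<close>, which is integrable by hypothesis.
\<close>

lemma herglotz_radial_limit:
  assumes fin: "(\<integral>\<^sup>+x. 1 / ennreal \<bar>cos (\<alpha> x - \<theta>)\<bar> \<partial>N) < \<infinity>"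
    and \<rho>: "\<And>n. 0 \<le> \<rho> n \<and> \<rho> n < 1" "\<rho> \<longlonglongrightarrow> 1"
  shows "(\<lambda>n. herglotz (of_real (\<rho> n) * cis (2 * \<theta>))) \<longlonglongrightarrow> \<i> * of_real (\<integral>x. tan (\<alpha> x - \<theta>) \<partial>N)"
proof -
  have "AE x in N. 1 / ennreal \<bar>cos (\<alpha> x - \<theta>)\<bar> \<noteq> \<infinity>"
    using fin by (intro nn_integral_noteq_infinite) (auto simp: less_top)
  then have ne: "AE x in N. cos (\<alpha> x - \<theta>) \<noteq> 0"
    by eventually_elim auto
  have eq: "of_real (\<rho> n) * cis (2 * \<theta>) * cis (- 2 * \<alpha> x) = of_real (\<rho> n) * cis (2 * (\<theta> - \<alpha> x))" for n x
    by (simp add: cis_mult mult.assoc algebra_simps)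
  have "(\<lambda>n. herglotz (of_real (\<rho> n) * cis (2 * \<theta>))) \<longlonglongrightarrow> (\<integral>x. \<i> * of_real (tan (\<alpha> x - \<theta>)) \<partial>N)"
    unfolding herglotz_def eq
  proof (rule integral_dominated_convergence)
    let ?w = "\<lambda>x. 2 / \<bar>cos (\<alpha> x - \<theta>)\<bar> + 1"
    have "integrable N (\<lambda>x. 1 / \<bar>cos (\<alpha> x - \<theta>)\<bar>)"
    proof (rule integrableI_bounded)
      have "(\<integral>\<^sup>+x. ennreal (norm (1 / \<bar>cos (\<alpha> x - \<theta>)\<bar>)) \<partial>N) = (\<integral>\<^sup>+x. 1 / ennreal \<bar>cos (\<alpha> x - \<theta>)\<bar> \<partial>N)"
      proof (rule nn_integral_cong_AE, use ne in eventually_elim)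
        fix x assume "cos (\<alpha> x - \<theta>) \<noteq> 0"
        then show "ennreal (norm (1 / \<bar>cos (\<alpha> x - \<theta>)\<bar>)) = 1 / ennreal \<bar>cos (\<alpha> x - \<theta>)\<bar>"
          by (simp add: one_divide_ennreal)
      qed
      with fin show "(\<integral>\<^sup>+x. ennreal (norm (1 / \<bar>cos (\<alpha> x - \<theta>)\<bar>)) \<partial>N) < \<infinity>" by simp
    qed measurable
    from integrable_mult_right[OF this, of 2] show "integrable N ?w" by simp
    show "AE x in N. (\<lambda>n. 2 / (1 + of_real (\<rho> n) * cis (2 * (\<theta> - \<alpha> x))) - 1) \<longlonglongrightarrow> \<i> * of_real (tan (\<alpha> x - \<theta>))"
      using ne
    proof eventually_elim
      fix x assume "cos (\<alpha> x - \<theta>) \<noteq> 0"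
      then have c: "cos (\<theta> - \<alpha> x) \<noteq> 0" by (metis cos_minus minus_diff_eq)
      then have nz: "1 + of_real 1 * cis (2 * (\<theta> - \<alpha> x)) \<noteq> 0"
        using norm_one_plus_cis_double[of "\<theta> - \<alpha> x"] by force
      have "(\<lambda>n. 2 / (1 + of_real (\<rho> n) * cis (2 * (\<theta> - \<alpha> x))) - 1) \<longlonglongrightarrow> 2 / (1 + of_real 1 * cis (2 * (\<theta> - \<alpha> x))) - 1"
        using nz \<rho>(2) by (intro tendsto_intros) auto
      also have "2 / (1 + of_real 1 * cis (2 * (\<theta> - \<alpha> x))) - 1 = \<i> * of_real (tan (\<alpha> x - \<theta>))"
        using cayley_cis[OF c] tan_minus[of "\<theta> - \<alpha> x"] by simp
      finally show "(\<lambda>n. 2 / (1 + of_real (\<rho> n) * cis (2 * (\<theta> - \<alpha> x))) - 1) \<longlonglongrightarrow> \<dots>" .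
    qed
    show "AE x in N. norm (2 / (1 + of_real (\<rho> n) * cis (2 * (\<theta> - \<alpha> x))) - 1) \<le> ?w x" for n
      using ne
    proof eventually_elim
      fix x assume "cos (\<alpha> x - \<theta>) \<noteq> 0"
      moreover have "cos (\<theta> - \<alpha> x) = cos (\<alpha> x - \<theta>)" by (metis cos_minus minus_diff_eq)
      moreover have "norm (1 + cis (2 * (\<theta> - \<alpha> x))) \<le> 2 * norm (1 + of_real (\<rho> n) * cis (2 * (\<theta> - \<alpha> x)))"
        using \<rho>(1)[of n] by (intro norm_one_plus_radial) auto
      ultimately have le: "\<bar>cos (\<alpha> x - \<theta>)\<bar> \<le> norm (1 + of_real (\<rho> n) * cis (2 * (\<theta> - \<alpha> x)))"
          and pos: "0 < \<bar>cos (\<alpha> x - \<theta>)\<bar>"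
        unfolding norm_one_plus_cis_double by auto
      have "norm (2 / (1 + of_real (\<rho> n) * cis (2 * (\<theta> - \<alpha> x))) - 1)
          \<le> norm (2 / (1 + of_real (\<rho> n) * cis (2 * (\<theta> - \<alpha> x)))) + norm (1::complex)"
        by (rule norm_triangle_ineq4)
      also have "norm (2 / (1 + of_real (\<rho> n) * cis (2 * (\<theta> - \<alpha> x)))) = 2 / norm (1 + of_real (\<rho> n) * cis (2 * (\<theta> - \<alpha> x)))"
        by (simp add: norm_divide)
      also have "\<dots> \<le> 2 / \<bar>cos (\<alpha> x - \<theta>)\<bar>"
        using le pos by (intro divide_left_mono mult_pos_pos) auto
      finally show "norm (2 / (1 + of_real (\<rho> n) * cis (2 * (\<theta> - \<alpha> x))) - 1) \<le> ?w x" by simp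
    qed
    have [measurable]: "cis \<in> borel_measurable borel" 
      by (intro borel_measurable_continuous_onI continuous_intros)
    show "(\<lambda>x. 2 / (1 + of_real (\<rho> n) * cis (2 * (\<theta> - \<alpha> x))) - 1) \<in> borel_measurable N" for n
      by measurable
    show "(\<lambda>x. \<i> * of_real (tan (\<alpha> x - \<theta>))) \<in> borel_measurable N"
      unfolding tan_def by measurable
  qed
  then show ?thesis by simp
qed

text \<open>
  The mean value property of \<open>exp (- t F)\<close> on circles of radius \<open>\<rho>\<^sub>n \<rightarrow> 1\<close>.  The function is bounded by
  \<open>1\<close> because the real part of \<open>F\<close> is nonnegative, which justifies the limit under the integral.
\<close>

lemma tan_transform_exp_moment:
  assumes fin: "AE s in unif01. (\<integral>\<^sup>+x. 1 / ennreal \<bar>cos (\<alpha> x - pi * s)\<bar> \<partial>N) < \<infinity>" and t: "0 \<le> t"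
  shows "(\<integral>s. exp (- of_real t * (\<i> * of_real (\<integral>x. tan (\<alpha> x - pi * s) \<partial>N))) \<partial>unif01) = exp (- of_real t :: complex)"
proof -
  interpret u: prob_space unif01 by (rule prob_space_unif01)
  define \<rho> where "\<rho> = (\<lambda>n. 1 - 1 / real (n + 2))"
  have \<rho>: "0 < \<rho> n" "\<rho> n < 1" for n by (auto simp: \<rho>_def field_simps)
  have \<rho>_lim: "\<rho> \<longlonglongrightarrow> 1" unfolding \<rho>_def by real_asymp
  define h where "h = (\<lambda>z. exp (- of_real t * herglotz z))"
  have hol: "h holomorphic_on ball 0 1"
    unfolding h_def by (intro holomorphic_intros herglotz_holomorphic)
  have cont: "continuous_on UNIV (\<lambda>s. h (of_real (\<rho> n) * cis (2 * (pi * s))))" for n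
  proof (rule continuous_on_compose2[OF holomorphic_on_imp_continuous_on[OF hol]])
    show "continuous_on UNIV (\<lambda>s. of_real (\<rho> n) * cis (2 * (pi * s)))"
      by (intro continuous_intros)
  qed (use \<rho>[of n] in \<open>auto simp: norm_mult\<close>)
  have const: "(\<integral>s. h (of_real (\<rho> n) * cis (2 * (pi * s))) \<partial>unif01) = exp (- of_real t)" for n
    using mean_value_unif01[OF hol \<rho>[of n]] by (simp add: h_def herglotz_0 mult.assoc)
  have "(\<lambda>n. \<integral>s. h (of_real (\<rho> n) * cis (2 * (pi * s))) \<partial>unif01) \<longlonglongrightarrow>
      (\<integral>s. exp (- of_real t * (\<i> * of_real (\<integral>x. tan (\<alpha> x - pi * s) \<partial>N))) \<partial>unif01)"
  proof (rule integral_dominated_convergence)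
    show "integrable unif01 (\<lambda>_. 1::real)" by simp
    show "AE s in unif01. (\<lambda>n. h (of_real (\<rho> n) * cis (2 * (pi * s)))) \<longlonglongrightarrow>
        exp (- of_real t * (\<i> * of_real (\<integral>x. tan (\<alpha> x - pi * s) \<partial>N)))"
      using fin
    proof eventually_elim
      case (elim s)
      have "(\<lambda>n. herglotz (of_real (\<rho> n) * cis (2 * (pi * s)))) \<longlonglongrightarrow> \<i> * of_real (\<integral>x. tan (\<alpha> x - pi * s) \<partial>N)"
        using \<rho> by (intro herglotz_radial_limit[OF elim] \<rho>_lim) (auto intro: less_imp_le)
      then show ?case unfolding h_def by (intro tendsto_intros)
    qed
    show "AE s in unif01. norm (h (of_real (\<rho> n) * cis (2 * (pi * s)))) \<le> 1" for n
    proof (rule AE_I2)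
      fix s
      have "0 \<le> Re (herglotz (of_real (\<rho> n) * cis (2 * (pi * s))))"
        using \<rho>[of n] by (intro Re_herglotz_nonneg) (auto simp: norm_mult)
      then show "norm (h (of_real (\<rho> n) * cis (2 * (pi * s)))) \<le> 1"
        using t by (simp add: h_def norm_exp_eq_Re)
    qed
    show "(\<lambda>s. h (of_real (\<rho> n) * cis (2 * (pi * s)))) \<in> borel_measurable unif01" for n
      using borel_measurable_continuous_onI[OF cont] by (simp cong: measurable_cong_sets)
    show "(\<lambda>s. exp (- of_real t * (\<i> * of_real (\<integral>x. tan (\<alpha> x - pi * s) \<partial>N)))) \<in> borel_measurable unif01"
      unfolding tan_def by measurable
  qed
  then show ?thesis unfolding const by (simp add: LIMSEQ_const_iff)
qed

lemma measurable_tan_transform [measurable]: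
  "(\<lambda>s. \<integral>x. tan (\<alpha> x - pi * s) \<partial>N) \<in> borel_measurable borel"
  unfolding tan_def by measurable

text \<open>
  For \<open>u \<le> 0\<close> this is the previous moment; for \<open>u > 0\<close> take complex conjugates.
\<close>

lemma char_tan_transform:
  assumes fin: "AE s in unif01. (\<integral>\<^sup>+x. 1 / ennreal \<bar>cos (\<alpha> x - pi * s)\<bar> \<partial>N) < \<infinity>"
  shows "char (distr unif01 borel (\<lambda>s. \<integral>x. tan (\<alpha> x - pi * s) \<partial>N)) u = of_real (exp (- \<bar>u\<bar>))"
proof -
  define X where "X = (\<lambda>s. \<integral>x. tan (\<alpha> x - pi * s) \<partial>N)"
  have [measurable]: "X \<in> borel_measurable borel" unfolding X_def by measurable
  have char: "char (distr unif01 borel X) u = (\<integral>s. exp (\<i> * of_real (u * X s)) \<partial>unif01)" for u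
    unfolding char_def by (subst integral_distr) auto
  have neg: "char (distr unif01 borel X) (- t) = of_real (exp (- t))" if "t \<ge> 0" for t
    using tan_transform_exp_moment[OF fin that] unfolding char
    by (simp add: X_def mult_ac exp_of_real[symmetric])
  have "char (distr unif01 borel X) u = cnj (char (distr unif01 borel X) (- u))"
  proof -
    have "cnj (exp (\<i> * of_real (- u * X s))) = exp (\<i> * of_real (u * X s))" for s
      by (simp add: exp_cnj)
    then have "char (distr unif01 borel X) u = (\<integral>s. cnj (exp (\<i> * of_real (- u * X s))) \<partial>unif01)"
      unfolding char by (simp only:)
    also have "\<dots> = cnj (char (distr unif01 borel X) (- u))"
      unfolding char by (rule Bochner_Integration.integral_cnj)
    finally show ?thesis .
  qed
  then have "char (distr unif01 borel X) u = of_real (exp (- \<bar>u\<bar>))"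
    using neg[of u] neg[of "- u"] by (cases "u \<ge> 0") auto
  then show ?thesis by (simp add: X_def)
qed

end

lemma AE_unif01_iff: "(AE s in unif01. P s) \<longleftrightarrow> (AE s in lborel. s \<in> {0..1} \<longrightarrow> P s)"
  unfolding unif01_def by (rule AE_uniform_measure) auto

lemma cauchy_distribution_tail:
  "emeasure (cauchy_distribution 0 1) {x<..} = ennreal (1 / 2 - arctan x / pi)"
proof -
  have "emeasure (cauchy_distribution 0 1) {x<..} = (\<integral>\<^sup>+y. ennreal (1 / (pi * (1 + y\<^sup>2))) * indicator {x<..} y \<partial>lborel)"
    unfolding cauchy_distribution_def by (subst emeasure_density) auto
  also have "\<dots> = (\<integral>\<^sup>+y. ennreal (1 / (pi * (1 + y\<^sup>2))) * indicator {x..} y \<partial>lborel)"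
    by (intro nn_integral_cong_AE) (use AE_lborel_singleton[of x] in \<open>auto split: split_indicator\<close>)
  also have "\<dots> = ennreal (1 / 2 - arctan x / pi)"
  proof (rule nn_integral_FTC_atLeast)
    show "DERIV (\<lambda>y. arctan y / pi) y :> 1 / (pi * (1 + y\<^sup>2))" for y :: real
      by (rule DERIV_cong[OF DERIV_cdivide[OF DERIV_arctan]]) (simp add: divide_inverse)
    have "((\<lambda>y. arctan y / pi) \<longlongrightarrow> (pi / 2) / pi) at_top"
      by (intro tendsto_intros tendsto_arctan_at_top) auto
    then show "((\<lambda>y. arctan y / pi) \<longlongrightarrow> 1 / 2) at_top" by simp
  qed auto
  finally show ?thesis .
qed

text \<open>
  For \<open>0 < s < 1\<close> the angle \<open>\<pi> / 2 - \<pi> s\<close> runs through \<open>(- \<pi> / 2, \<pi> / 2)\<close>, where the tangent can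
  be inverted; both tails are then \<open>1 / 2 - arctan x / \<pi>\<close>.
\<close>

lemma cauchy_distribution_eq_tan_uniform:
  "cauchy_distribution 0 1 = distr unif01 borel (\<lambda>s. tan (pi / 2 - pi * s))"
proof (rule measure_eqI_lessThan)
  show "sets (cauchy_distribution 0 1) = sets borel" by (simp add: cauchy_distribution_def)
  show "emeasure (cauchy_distribution 0 1) {x<..} < \<infinity>" for x
    by (simp add: cauchy_distribution_tail)
  fix x
  have [measurable]: "(\<lambda>s. tan (pi / 2 - pi * s)) \<in> borel_measurable borel"
    unfolding tan_def by measurable
  define c where "c = 1 / 2 - arctan x / pi"
  have c: "0 < c" "c < 1"
    using arctan_lbound[of x] arctan_ubound[of x] by (auto simp: c_def field_simps)
  have "emeasure (distr unif01 borel (\<lambda>s. tan (pi / 2 - pi * s))) {x<..} = emeasure unif01 {s. x < tan (pi / 2 - pi * s)}"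
    by (subst emeasure_distr) (auto intro!: arg_cong[where f = "emeasure unif01"])
  also have "\<dots> = emeasure unif01 {0..<c}"
  proof (rule emeasure_eq_AE)
    show "AE s in unif01. (s \<in> {s. x < tan (pi / 2 - pi * s)}) = (s \<in> {0..<c})"
      unfolding AE_unif01_iff
      using AE_lborel_singleton[of 0] AE_lborel_singleton[of 1]
    proof (eventually_elim, intro impI)
      fix s :: real assume "s \<noteq> 0" "s \<noteq> 1" "s \<in> {0..1}"
      then have s: "0 < s" "s < 1" by auto
      then have "- (pi / 2) < pi / 2 - pi * s" "pi / 2 - pi * s < pi / 2" by auto
      then have "arctan (tan (pi / 2 - pi * s)) = pi / 2 - pi * s" by (rule arctan_tan)
      then have "x < tan (pi / 2 - pi * s) \<longleftrightarrow> arctan x < pi / 2 - pi * s"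
        by (metis arctan_less_iff)
      also have "\<dots> \<longleftrightarrow> s < c" by (auto simp: c_def field_simps)
      finally show "(s \<in> {s. x < tan (pi / 2 - pi * s)}) = (s \<in> {0..<c})" using s by auto
    qed
  qed auto
  also have "\<dots> = ennreal c"
  proof -
    have "{0..1} \<inter> {0..<c} = {0..<c}" using c by auto
    then show ?thesis using c by (simp add: unif01_def emeasure_uniform_measure divide_ennreal_def)
  qed
  finally show "emeasure (cauchy_distribution 0 1) {x<..} = emeasure (distr unif01 borel (\<lambda>s. tan (pi / 2 - pi * s))) {x<..}"
    by (simp add: cauchy_distribution_tail c_def)
qed auto

text \<open>
  The characteristic function does not depend on \<open>N\<close> and \<open>\<alpha>\<close>.  Taking the constant \<open>\<alpha> = \<pi> / 2\<close> shows
  that the common law is that of the tangent of a uniform angle.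
\<close>

lemma tan_transform_cauchy:
  assumes N: "prob_space N" and \<alpha> [measurable]: "\<alpha> \<in> borel_measurable N"
    and fin: "AE s in unif01. (\<integral>\<^sup>+x. 1 / ennreal \<bar>cos (\<alpha> x - pi * s)\<bar> \<partial>N) < \<infinity>"
  shows "distr unif01 borel (\<lambda>s. \<integral>x. tan (\<alpha> x - pi * s) \<partial>N) = cauchy_distribution 0 1"
proof -
  interpret u: prob_space unif01 by (rule prob_space_unif01)
  \<comment> \<open>A point mass, on which the constant angle \<open>\<pi> / 2\<close> is averaged.\<close>
  let ?\<delta> = "return borel (0::real)"
  have \<delta>: "prob_space ?\<delta>" by (rule prob_space_return) simp
  have [measurable]: "(\<lambda>s. \<integral>x. tan (\<alpha> x - pi * s) \<partial>N) \<in> borel_measurable borel"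
    by (rule measurable_tan_transform[OF N \<alpha>])
  have [measurable]: "(\<lambda>s. tan (pi / 2 - pi * s)) \<in> borel_measurable borel"
    unfolding tan_def by measurable
  have \<delta>_tan: "(\<integral>x. tan (pi / 2 - pi * s) \<partial>?\<delta>) = tan (pi / 2 - pi * s)" for s
    using prob_space.prob_space[OF \<delta>] by simp
  have "measure ?\<delta> UNIV = 1"
    using prob_space.prob_space[OF \<delta>] by simp
  note \<delta>_tan = \<delta>_tan this
  have "AE s in unif01. (\<integral>\<^sup>+x. 1 / ennreal \<bar>cos (pi / 2 - pi * s)\<bar> \<partial>?\<delta>) < \<infinity>"
    unfolding AE_unif01_iff
    using AE_lborel_singleton[of 0] AE_lborel_singleton[of 1]
  proof (eventually_elim, intro impI)
    fix s :: real assume "s \<noteq> 0" "s \<noteq> 1" "s \<in> {0..1}"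
    then have "sin (pi * s) > 0" by (intro sin_gt_zero) auto
    then have "cos (pi / 2 - pi * s) \<noteq> 0" by (simp add: cos_diff)
    then show "(\<integral>\<^sup>+x. 1 / ennreal \<bar>cos (pi / 2 - pi * s)\<bar> \<partial>?\<delta>) < \<infinity>"
      by (simp add: prob_space.emeasure_space_1[OF \<delta>] one_divide_ennreal)
  qed
  from char_tan_transform[OF \<delta> _ this]
  have "char (distr unif01 borel (\<lambda>s. tan (pi / 2 - pi * s))) u = of_real (exp (- \<bar>u\<bar>))" for u
    by (simp add: \<delta>_tan)
  then have "char (distr unif01 borel (\<lambda>s. \<integral>x. tan (\<alpha> x - pi * s) \<partial>N)) =
      char (distr unif01 borel (\<lambda>s. tan (pi / 2 - pi * s)))"
    using char_tan_transform[OF N \<alpha> fin] by (intro ext) simp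
  then have "distr unif01 borel (\<lambda>s. \<integral>x. tan (\<alpha> x - pi * s) \<partial>N) =
      distr unif01 borel (\<lambda>s. tan (pi / 2 - pi * s))"
    by (intro Levy_uniqueness)
       (auto simp: real_distribution_def real_distribution_axioms_def intro!: u.prob_space_distr)
  then show ?thesis by (simp add: cauchy_distribution_eq_tan_uniform)
qed

section \<open>Frames, oriented planes and rotations\<close>

definition frame_rot :: "real \<Rightarrow> (real^'n) \<times> (real^'n) \<Rightarrow> (real^'n) \<times> (real^'n)" where
  "frame_rot \<theta> w = (cos \<theta> *\<^sub>R fst w + sin \<theta> *\<^sub>R snd w, cos \<theta> *\<^sub>R snd w - sin \<theta> *\<^sub>R fst w)"

lemma orthonormal_frames_iff:
  "(u, v) \<in> orthonormal_frames \<longleftrightarrow> u \<bullet> u = 1 \<and> v \<bullet> v = 1 \<and> u \<bullet> v = 0"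
  by (auto simp: orthonormal_frames_def norm_eq_1)

lemma frame_rot_orthonormal:
  assumes "w \<in> orthonormal_frames" shows "frame_rot \<theta> w \<in> orthonormal_frames"
  using assms sin_cos_squared_add[of \<theta>]
  by (cases w) (auto simp: orthonormal_frames_iff frame_rot_def inner_simps inner_commute power2_eq_square add.commute)

lemma frame_rot_add: "frame_rot s (frame_rot t w) = frame_rot (s + t) w"
  by (simp add: frame_rot_def cos_add sin_add algebra_simps)

lemma frame_rot_0 [simp]: "frame_rot 0 w = w"
  by (simp add: frame_rot_def)

lemma space_frame_space: "space frame_space = orthonormal_frames"
  by (simp add: frame_space_def space_restrict_space)

lemma measurable_into_frame_space:
  assumes "g \<in> borel_measurable N" "\<And>x. x \<in> space N \<Longrightarrow> g x \<in> orthonormal_frames"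
  shows "g \<in> measurable N frame_space"
  using assms unfolding frame_space_def by (intro measurable_restrict_space2) auto

lemma measurable_from_frame_space:
  assumes "g \<in> borel_measurable borel" shows "g \<in> measurable frame_space borel"
  using assms unfolding frame_space_def by (rule measurable_restrict_space1)

lemma measurable_frame_space_fst [measurable]: "fst \<in> borel_measurable frame_space"
  and measurable_frame_space_snd [measurable]: "snd \<in> borel_measurable frame_space"
  by (auto intro!: measurable_from_frame_space borel_measurable_continuous_onI continuous_intros)

lemma measurable_frame_rot:
  assumes [measurable]: "\<theta> \<in> borel_measurable N" and g [measurable]: "g \<in> measurable N frame_space"
  shows "(\<lambda>x. frame_rot (\<theta> x) (g x)) \<in> measurable N frame_space"
proof (rule measurable_into_frame_space)
  show "(\<lambda>x. frame_rot (\<theta> x) (g x)) \<in> borel_measurable N"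
    unfolding frame_rot_def by measurable
  show "frame_rot (\<theta> x) (g x) \<in> orthonormal_frames" if "x \<in> space N" for x
    using frame_rot_orthonormal[OF measurable_space[OF g that, unfolded space_frame_space]] .
qed

lemma span_frame_rot_le:
  "span {fst (frame_rot \<theta> w), snd (frame_rot \<theta> w)} \<subseteq> span {fst w, snd w}"
proof (intro span_minimal subspace_span)
  have "fst w \<in> span {fst w, snd w}" "snd w \<in> span {fst w, snd w}"
    by (auto intro: span_base)
  then show "{fst (frame_rot \<theta> w), snd (frame_rot \<theta> w)} \<subseteq> span {fst w, snd w}"
    by (simp add: frame_rot_def span_add span_diff span_scale)
qed

lemma span_frame_rot:
  "span {fst (frame_rot \<theta> w), snd (frame_rot \<theta> w)} = span {fst w, snd w}"
proof
  have "span {fst (frame_rot (- \<theta>) (frame_rot \<theta> w)), snd (frame_rot (- \<theta>) (frame_rot \<theta> w))}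
      \<subseteq> span {fst (frame_rot \<theta> w), snd (frame_rot \<theta> w)}"
    by (rule span_frame_rot_le)
  then show "span {fst w, snd w} \<subseteq> span {fst (frame_rot \<theta> w), snd (frame_rot \<theta> w)}"
    by (simp add: frame_rot_add)
qed (rule span_frame_rot_le)

lemma oriented_span_frame_rot:
  "oriented_span (fst (frame_rot \<theta> w)) (snd (frame_rot \<theta> w)) = oriented_span (fst w) (snd w)"
proof -
  have "(x \<bullet> fst (frame_rot \<theta> w)) * (y \<bullet> snd (frame_rot \<theta> w)) - (x \<bullet> snd (frame_rot \<theta> w)) * (y \<bullet> fst (frame_rot \<theta> w))
     = (x \<bullet> fst w) * (y \<bullet> snd w) - (x \<bullet> snd w) * (y \<bullet> fst w)" for x y
  proof -
    have det: "(c * p + s * q) * (c * t - s * r) - (c * q - s * p) * (c * r + s * t)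
        = (s\<^sup>2 + c\<^sup>2) * (p * t - q * r)" for c s p q r t :: real
      by (simp add: power2_eq_square algebra_simps)
    show ?thesis
      using det[of "cos \<theta>" "x \<bullet> fst w" "sin \<theta>" "x \<bullet> snd w" "y \<bullet> snd w" "y \<bullet> fst w"]
      by (simp add: frame_rot_def inner_simps)
  qed
  then show ?thesis unfolding oriented_span_def span_frame_rot by simp
qed

lemma in_oriented_span_self: "(u, v) \<in> orthonormal_frames \<Longrightarrow> (u, v) \<in> oriented_span u v"
  by (auto simp: oriented_span_def orthonormal_frames_iff inner_commute)

text \<open>
  In the coordinates of \<open>(u, v)\<close> the basis \<open>(x, y)\<close> is an orthogonal \<open>2 \<times> 2\<close> matrix of positive
  determinant, that is, a rotation matrix.
\<close>

lemma oriented_span_is_orbit: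
  assumes uv: "(u, v) \<in> orthonormal_frames" and xy: "(x, y) \<in> oriented_span u v"
  obtains \<theta> where "(x, y) = frame_rot \<theta> (u, v)"
proof -
  have fr: "u \<bullet> u = 1" "v \<bullet> v = 1" "u \<bullet> v = 0" "v \<bullet> u = 0"
    using uv by (auto simp: orthonormal_frames_iff inner_commute)
  have xyo: "x \<bullet> x = 1" "y \<bullet> y = 1" "x \<bullet> y = 0"
    and det: "(x \<bullet> u) * (y \<bullet> v) - (x \<bullet> v) * (y \<bullet> u) > 0"
    and sp: "span {x, y} = span {u, v}"
    using xy by (auto simp: oriented_span_def orthonormal_frames_iff)
  have coords: "z = (z \<bullet> u) *\<^sub>R u + (z \<bullet> v) *\<^sub>R v" if "z \<in> {x, y}" for z
  proof -
    have "z \<in> span {u, v}" using span_base[OF that] sp by simp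
    then obtain a where "z - a *\<^sub>R u \<in> span {v}"
      using span_breakdown_eq[of z u "{v}"] by auto
    then obtain b where "z - a *\<^sub>R u = b *\<^sub>R v"
      by (auto simp: span_singleton)
    then have "z = a *\<^sub>R u + b *\<^sub>R v" by (simp add: algebra_simps)
    moreover from this have "z \<bullet> u = a" "z \<bullet> v = b" using fr by (simp_all add: inner_simps)
    ultimately show ?thesis by simp
  qed
  \<comment> \<open>The rows \<open>(a, b)\<close> and \<open>(c, d)\<close> are the coordinates of \<open>x\<close> and \<open>y\<close>.\<close>
  define a b c d where "a = x \<bullet> u" "b = x \<bullet> v" "c = y \<bullet> u" "d = y \<bullet> v"
  note abcd = this
  have x: "x = a *\<^sub>R u + b *\<^sub>R v" and y: "y = c *\<^sub>R u + d *\<^sub>R v"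
    using coords abcd by auto
  have eqs: "a * a + b * b = 1" "c * c + d * d = 1" "a * c + b * d = 0"
    using xyo fr unfolding x y by (auto simp: inner_simps algebra_simps)
  have det: "a * d - b * c > 0" using det abcd by simp
  have sq: "(a * d - b * c)\<^sup>2 = 1"
  proof -
    have "(a * d - b * c)\<^sup>2 = (a * a + b * b) * (c * c + d * d) - (a * c + b * d)\<^sup>2"
      by (simp add: power2_eq_square algebra_simps)
    then show ?thesis by (simp add: eqs)
  qed
  have "a * d - b * c = 1" using sq det by (simp add: power2_eq_1_iff)
  have "c = - b"
  proof -
    have "c = (a * a + b * b) * c" by (simp add: eqs)
    also have "\<dots> = a * (a * c + b * d) - b * (a * d - b * c)" by (simp add: algebra_simps)
    finally show ?thesis by (simp add: eqs \<open>a * d - b * c = 1\<close>)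
  qed
  moreover have "d = a"
  proof -
    have "d = (a * a + b * b) * d" by (simp add: eqs)
    also have "\<dots> = b * (a * c + b * d) + a * (a * d - b * c)" by (simp add: algebra_simps)
    finally show ?thesis by (simp add: eqs \<open>a * d - b * c = 1\<close>)
  qed
  moreover obtain \<theta> where "a = cos \<theta>" "b = sin \<theta>"
    using sincos_total_2pi[of a b] eqs(1) by (auto simp: power2_eq_square)
  ultimately have "(x, y) = frame_rot \<theta> (u, v)"
    by (simp add: frame_rot_def x y)
  then show ?thesis by (rule that)
qed

lemma oriented_planes_generators:
  "{A. A \<subseteq> (\<lambda>(u, v). oriented_span u v) ` orthonormal_frames \<and>
       {(u, v) \<in> orthonormal_frames. oriented_span u v \<in> A} \<in> sets frame_space}
    \<subseteq> Pow ((\<lambda>(u, v). oriented_span u v) ` orthonormal_frames)"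
  by auto

lemma space_oriented_planes:
  "space oriented_planes = (\<lambda>(u, v). oriented_span u v) ` orthonormal_frames"
  unfolding oriented_planes_def by (rule space_measure_of) (rule oriented_planes_generators)

lemma measurable_oriented_span:
  "(\<lambda>w. oriented_span (fst w) (snd w)) \<in> measurable frame_space oriented_planes"
  unfolding oriented_planes_def
proof (rule measurable_measure_of[OF oriented_planes_generators])
  show "(\<lambda>w. oriented_span (fst w) (snd w)) \<in> space frame_space \<rightarrow> (\<lambda>(u, v). oriented_span u v) ` orthonormal_frames"
    by (auto simp: space_frame_space)
qed (auto simp: space_frame_space vimage_def Int_def case_prod_unfold conj_commute)

lemma sets_oriented_planesI:
  assumes "S \<subseteq> space oriented_planes"
    "{w \<in> orthonormal_frames. oriented_span (fst w) (snd w) \<in> S} \<in> sets frame_space"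
  shows "S \<in> sets oriented_planes"
  using assms oriented_planes_generators unfolding space_oriented_planes oriented_planes_def
  by (subst sets_measure_of) (auto intro!: sigma_sets.Basic simp: case_prod_unfold)

text \<open>
  The rotation in the \<open>(i, j)\<close> coordinate plane, acting from the right, mixes the two columns.
\<close>

lemma exists_rotation_matrix:
  fixes i j :: "'n::finite"
  assumes "i \<noteq> j"
  shows "\<exists>R :: real^'n^'n. orthogonal_matrix R \<and>
    (\<forall>Q :: real^'n^'n. (column i (Q ** R), column j (Q ** R)) = frame_rot \<theta> (column i Q, column j Q))"
proof -
  define c :: "'n \<Rightarrow> real^'n" where "c = (\<lambda>k. if k = i then cos \<theta> *\<^sub>R axis i 1 + sin \<theta> *\<^sub>R axis j 1
      else if k = j then cos \<theta> *\<^sub>R axis j 1 - sin \<theta> *\<^sub>R axis i 1 else axis k 1)"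
  define R :: "real^'n^'n" where "R = (\<chi> a b. c b $ a)"
  have col: "column k R = c k" for k by (simp add: R_def column_def vec_eq_iff)
  have "orthogonal_matrix R"
    unfolding orthogonal_matrix_orthonormal_columns col norm_eq_1 orthogonal_def
    using assms sin_cos_squared_add[of \<theta>]
    by (auto simp: c_def inner_simps inner_axis_axis power2_eq_square add.commute)
  moreover have "column k (Q ** R) = Q *v c k" for k and Q :: "real^'n^'n"
    unfolding col[symmetric] by (simp add: column_def matrix_matrix_mult_def matrix_vector_mult_def vec_eq_iff)
  then have "(column i (Q ** R), column j (Q ** R)) = frame_rot \<theta> (column i Q, column j Q)" for Q :: "real^'n^'n"
    using assms
    by (simp add: c_def frame_rot_def matrix_vector_right_distrib matrix_vector_mult_diff_distrib
        matrix_vector_mult_scaleR matrix_vector_mult_basis)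
  ultimately show ?thesis by blast
qed

lemma haar_two_frame_columns:
  assumes "haar_two_frame M U V"
  shows "\<exists>H i j. haar_orthogonal H \<and> i \<noteq> j \<and>
    (\<lambda>Q. (column i Q, column j Q)) \<in> measurable H frame_space \<and>
    (\<forall>f \<in> borel_measurable frame_space.
       (\<integral>\<^sup>+\<omega>. f (U \<omega>, V \<omega>) \<partial>M) = (\<integral>\<^sup>+Q. f (column i Q, column j Q) \<partial>H))"
proof -
  obtain H i j where H: "haar_orthogonal H" "i \<noteq> j" and
    eq: "distr M frame_space (\<lambda>\<omega>. (U \<omega>, V \<omega>)) = distr H frame_space (\<lambda>Q. (column i Q, column j Q))"
    and UV: "(\<lambda>\<omega>. (U \<omega>, V \<omega>)) \<in> measurable M frame_space"
    using assms by (auto simp: haar_two_frame_def)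
  have cols: "(\<lambda>Q. (column i Q, column j Q)) \<in> measurable H frame_space"
  proof (rule measurable_into_frame_space)
    show "(\<lambda>Q. (column i Q, column j Q)) \<in> borel_measurable H"
      by (intro measurable_from_haar_orthogonal[OF H(1)] borel_measurable_continuous_onI
          continuous_on_Pair continuous_on_column)
    show "(column i Q, column j Q) \<in> orthonormal_frames" if "Q \<in> space H" for Q
      using that H(2) haar_orthogonal_space[OF H(1)]
      by (auto simp: orthonormal_frames_def orthogonal_matrix_orthonormal_columns orthogonal_def)
  qed
  have "(\<integral>\<^sup>+\<omega>. f (U \<omega>, V \<omega>) \<partial>M) = (\<integral>\<^sup>+Q. f (column i Q, column j Q) \<partial>H)"
    if f: "f \<in> borel_measurable frame_space" for f
    using nn_integral_distr[OF UV, of f] nn_integral_distr[OF cols, of f] f eq by simp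
  with H cols show ?thesis by blast
qed

text \<open>
  The rotation acts on the columns as right multiplication by a fixed orthogonal matrix.
\<close>

lemma haar_two_frame_rotation_invariant:
  assumes UV: "haar_two_frame M U V" and f: "f \<in> borel_measurable frame_space"
  shows "(\<integral>\<^sup>+\<omega>. f (frame_rot \<theta> (U \<omega>, V \<omega>)) \<partial>M) = (\<integral>\<^sup>+\<omega>. f (U \<omega>, V \<omega>) \<partial>M)"
proof -
  obtain H i j where H: "haar_orthogonal H" "i \<noteq> j"
    and cols: "(\<lambda>Q. (column i Q, column j Q)) \<in> measurable H frame_space"
    and eq': "\<forall>f \<in> borel_measurable frame_space.
       (\<integral>\<^sup>+\<omega>. f (U \<omega>, V \<omega>) \<partial>M) = (\<integral>\<^sup>+Q. f (column i Q, column j Q) \<partial>H)"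
    using haar_two_frame_columns[OF UV] by blast
  note eq = bspec[OF eq']
  obtain R where R: "orthogonal_matrix R"
    "\<forall>Q \<in> space H. (column i (Q ** R), column j (Q ** R)) = frame_rot \<theta> (column i Q, column j Q)"
    using exists_rotation_matrix[OF H(2), of \<theta>] by blast
  have "(\<integral>\<^sup>+\<omega>. f (frame_rot \<theta> (U \<omega>, V \<omega>)) \<partial>M) = (\<integral>\<^sup>+Q. f (frame_rot \<theta> (column i Q, column j Q)) \<partial>H)"
    by (intro eq[where x = "\<lambda>w. f (frame_rot \<theta> w)"] measurable_compose[OF measurable_frame_rot f]) auto
  also have "\<dots> = (\<integral>\<^sup>+Q. f (column i (Q ** R), column j (Q ** R)) \<partial>H)"
    by (intro nn_integral_cong) (simp add: R(2))
  also have "\<dots> = (\<integral>\<^sup>+Q. f (column i Q, column j Q) \<partial>H)"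
    using haar_right_invariant[OF H(1) R(1) measurable_compose[OF cols f]] .
  also have "\<dots> = (\<integral>\<^sup>+\<omega>. f (U \<omega>, V \<omega>) \<partial>M)"
    using f by (rule eq[symmetric])
  finally show ?thesis .
qed

lemma haar_two_frame_first_vector:
  assumes UV: "haar_two_frame M U V" and \<sigma>: "haar_sphere \<sigma>" and f: "f \<in> borel_measurable borel"
  shows "(\<integral>\<^sup>+\<omega>. f (U \<omega>) \<partial>M) = (\<integral>\<^sup>+u. f u \<partial>\<sigma>)"
proof -
  obtain H i j where H: "haar_orthogonal H"
    and eq': "\<forall>f \<in> borel_measurable frame_space.
       (\<integral>\<^sup>+\<omega>. f (U \<omega>, V \<omega>) \<partial>M) = (\<integral>\<^sup>+Q. f (column i Q, column j Q) \<partial>H)"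
    using haar_two_frame_columns[OF UV] by blast
  note eq = bspec[OF eq']
  have "(\<lambda>w. f (fst w)) \<in> borel_measurable frame_space"
    by (rule measurable_compose[OF measurable_frame_space_fst f])
  from eq[OF this] haar_sphere_eq_column_law[OF H \<sigma> f, of i] show ?thesis by simp
qed

section \<open>The angle of a projected vector\<close>

text \<open>
  The equation \<open>x sin t = y cos t\<close> says that \<open>(cos t, sin t)\<close> spans the line of \<open>(x, y)\<close>.  Unlike a
  polar representation it does not see the sign of the radius, so it determines \<open>t\<close> modulo \<open>\<pi>\<close>.
\<close>

lemma angle_mod_pi_unique:
  fixes x y :: real
  assumes "x \<noteq> 0 \<or> y \<noteq> 0" and t: "t \<in> {0..<pi}" "x * sin t = y * cos t"
    and t': "t' \<in> {0..<pi}" "x * sin t' = y * cos t'"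
  shows "t = t'"
proof -
  have "x * sin (t - t') = (x * sin t) * cos t' - cos t * (x * sin t')"
    by (simp add: sin_diff algebra_simps)
  also have "\<dots> = 0" unfolding t(2) t'(2) by simp
  finally have x: "x * sin (t - t') = 0" .
  have "y * sin (t - t') = sin t * (y * cos t') - (y * cos t) * sin t'"
    by (simp add: sin_diff algebra_simps)
  also have "\<dots> = 0" unfolding t(2)[symmetric] t'(2)[symmetric] by simp
  finally have y: "y * sin (t - t') = 0" .
  from x y assms(1) have "sin (t - t') = 0" by (metis mult_eq_0_iff)
  then have "t - t' = 0"
    by (rule sin_eq_0_pi[rotated 2]) (use t(1) t'(1) in auto)
  then show ?thesis by simp
qed

lemma sin_diff_rmod_pi: "sin (s - s rmod pi) = 0"
  by (simp add: rmod_def mult.commute sin_zero_iff_int2)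

lemma plane_proj_eq_0_iff:
  assumes "(e1, e2) \<in> orthonormal_frames"
  shows "plane_proj e1 e2 a = 0 \<longleftrightarrow> a \<bullet> e1 = 0 \<and> a \<bullet> e2 = 0"
proof
  assume "plane_proj e1 e2 a = 0"
  then have "plane_proj e1 e2 a \<bullet> e1 = 0" "plane_proj e1 e2 a \<bullet> e2 = 0" by simp_all
  then show "a \<bullet> e1 = 0 \<and> a \<bullet> e2 = 0"
    using assms by (simp add: plane_proj_def inner_simps orthonormal_frames_iff inner_commute)
qed (simp add: plane_proj_def)

text \<open>
  The description of \<open>t\<close> by the line equation is equivalent to the one by \<open>r > 0\<close> and the reduction
  modulo \<open>\<pi>\<close>: the signed radius \<open>\<rho> = x cos t + y sin t\<close> recovers the projection, and if it is negative,
  then \<open>t + \<pi>\<close> is an angle with radius \<open>- \<rho>\<close>.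
\<close>

lemma plane_angle_eqI:
  assumes fr: "(e1, e2) \<in> orthonormal_frames" and ne: "plane_proj e1 e2 a \<noteq> 0"
    and t: "t \<in> {0..<pi}" "(a \<bullet> e1) * sin t = (a \<bullet> e2) * cos t"
  shows "plane_angle e1 e2 a = t"
proof -
  have fr': "e1 \<bullet> e1 = 1" "e2 \<bullet> e2 = 1" "e1 \<bullet> e2 = 0" "e2 \<bullet> e1 = 0"
    using fr by (auto simp: orthonormal_frames_iff inner_commute)
  have ne': "a \<bullet> e1 \<noteq> 0 \<or> a \<bullet> e2 \<noteq> 0" using plane_proj_eq_0_iff[OF fr] ne by simp
  define P where "P = (\<lambda>t. \<exists>r s. r > 0 \<and> plane_proj e1 e2 a = r *\<^sub>R (cos s *\<^sub>R e1 + sin s *\<^sub>R e2) \<and> t = s rmod pi)"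
  have uniq: "t' = t" if Pt: "P t'" for t'
  proof -
    obtain r s where rs: "r > 0" "plane_proj e1 e2 a = r *\<^sub>R (cos s *\<^sub>R e1 + sin s *\<^sub>R e2)" "t' = s rmod pi"
      using Pt unfolding P_def by blast
    have "plane_proj e1 e2 a \<bullet> e1 = a \<bullet> e1" "plane_proj e1 e2 a \<bullet> e2 = a \<bullet> e2"
      using fr' by (simp_all add: plane_proj_def inner_simps)
    then have xy: "a \<bullet> e1 = r * cos s" "a \<bullet> e2 = r * sin s"
      unfolding rs(2) using fr' by (simp_all add: inner_simps)
    have "sin (s - t') = 0" unfolding rs(3) by (rule sin_diff_rmod_pi)
    then have "sin s * cos t' = cos s * sin t'" by (simp add: sin_diff)
    then have "(a \<bullet> e1) * sin t' = (a \<bullet> e2) * cos t'" by (simp add: xy)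
    moreover have "t' \<in> {0..<pi}"
      using rs(3) rmod_nonneg[of pi s] rmod_less[of pi s] by auto
    ultimately show "t' = t" using angle_mod_pi_unique[OF ne'] t by blast
  qed
  have "P t"
  proof -
    define \<rho> where "\<rho> = (a \<bullet> e1) * cos t + (a \<bullet> e2) * sin t"
    have sc: "x * (cos t)\<^sup>2 + x * (sin t)\<^sup>2 = x" for x
      using sin_cos_squared_add[of t] by (metis add.commute distrib_left mult.right_neutral)
    have x: "\<rho> * cos t = a \<bullet> e1"
    proof -
      have "\<rho> * cos t = (a \<bullet> e1) * (cos t)\<^sup>2 + sin t * ((a \<bullet> e2) * cos t)"
        by (simp add: \<rho>_def power2_eq_square algebra_simps)
      also have "\<dots> = (a \<bullet> e1) * (cos t)\<^sup>2 + (a \<bullet> e1) * (sin t)\<^sup>2"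
        unfolding t(2)[symmetric] by (simp add: power2_eq_square)
      finally show ?thesis by (simp add: sc)
    qed
    have y: "\<rho> * sin t = a \<bullet> e2"
    proof -
      have "\<rho> * sin t = ((a \<bullet> e1) * sin t) * cos t + (a \<bullet> e2) * (sin t)\<^sup>2"
        by (simp add: \<rho>_def power2_eq_square algebra_simps)
      also have "\<dots> = (a \<bullet> e2) * (cos t)\<^sup>2 + (a \<bullet> e2) * (sin t)\<^sup>2"
        unfolding t(2) by (simp add: power2_eq_square)
      finally show ?thesis by (simp add: sc)
    qed
    have "\<rho> \<noteq> 0" using ne' x y by auto
    have tmod: "t rmod pi = t" using t(1) by (intro rmod_idem) auto
    have proj: "plane_proj e1 e2 a = \<rho> *\<^sub>R (cos t *\<^sub>R e1 + sin t *\<^sub>R e2)"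
      unfolding plane_proj_def x[symmetric] y[symmetric] by (simp add: scaleR_add_right)
    show "P t"
    proof (cases "\<rho> > 0")
      case True
      with proj tmod show ?thesis unfolding P_def by metis
    next
      case False
      have "- \<rho> > 0" using False \<open>\<rho> \<noteq> 0\<close> by simp
      moreover have "plane_proj e1 e2 a = (- \<rho>) *\<^sub>R (cos (t + pi) *\<^sub>R e1 + sin (t + pi) *\<^sub>R e2)"
        unfolding proj by (simp add: scaleR_add_right scaleR_diff_right)
      moreover have "t = (t + pi) rmod pi"
        by (rule rmod_unique[of _ _ _ 1, symmetric]) (use t(1) in auto)
      ultimately show ?thesis unfolding P_def by blast
    qed
  qed
  then have "(THE t. P t) = t" using uniq by (rule the_equality)
  moreover have "plane_angle e1 e2 a = (THE t. P t)"
    using ne unfolding plane_angle_def P_def by (rule if_not_P)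
  ultimately show ?thesis by simp
qed

text \<open>
  An explicit formula, which makes the measurability of the angle evident.
\<close>

lemma plane_angle_eq_arctan:
  assumes fr: "(e1, e2) \<in> orthonormal_frames"
  shows "plane_angle e1 e2 a =
    (if a \<bullet> e1 = 0 then (if a \<bullet> e2 = 0 then 0 else pi / 2) else arctan ((a \<bullet> e2) / (a \<bullet> e1)) rmod pi)"
proof -
  consider "a \<bullet> e1 = 0" "a \<bullet> e2 = 0" | "a \<bullet> e1 = 0" "a \<bullet> e2 \<noteq> 0" | "a \<bullet> e1 \<noteq> 0" by blast
  then show ?thesis
  proof cases
    case 1
    then show ?thesis using plane_proj_eq_0_iff[OF fr] by (simp add: plane_angle_def)
  next
    case 2
    then show ?thesis
      using plane_angle_eqI[OF fr, of a "pi / 2"] plane_proj_eq_0_iff[OF fr] by simp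
  next
    case 3
    let ?s = "arctan ((a \<bullet> e2) / (a \<bullet> e1))"
    let ?t = "?s rmod pi"
    have "sin (?s - ?t) = 0" by (rule sin_diff_rmod_pi)
    then have eq: "sin ?s * cos ?t = cos ?s * sin ?t" by (simp add: sin_diff)
    have cs: "cos ?s \<noteq> 0" by (rule cos_arctan_not_zero)
    have "tan ?s = (a \<bullet> e2) / (a \<bullet> e1)" by (rule tan_arctan)
    then have tan: "(a \<bullet> e1) * sin ?s = (a \<bullet> e2) * cos ?s"
      using cs 3 by (simp add: tan_def frac_eq_eq mult.commute)
    have "cos ?s * ((a \<bullet> e1) * sin ?t) = (a \<bullet> e1) * (cos ?s * sin ?t)" by (rule mult.left_commute)
    also have "\<dots> = ((a \<bullet> e1) * sin ?s) * cos ?t" by (simp only: eq[symmetric] mult.assoc)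
    also have "\<dots> = cos ?s * ((a \<bullet> e2) * cos ?t)" by (simp only: tan mult_ac)
    finally have "(a \<bullet> e1) * sin ?t = (a \<bullet> e2) * cos ?t"
      using cs mult_left_cancel by blast
    moreover have "?t \<in> {0..<pi}"
      using rmod_nonneg[of pi ?s] rmod_less[of pi ?s] by auto
    moreover have "plane_proj e1 e2 a \<noteq> 0" using 3 plane_proj_eq_0_iff[OF fr] by simp
    ultimately have "plane_angle e1 e2 a = ?t" by (intro plane_angle_eqI[OF fr])
    then show ?thesis using 3 by (simp only: if_False)
  qed
qed

lemma plane_angle_range:
  "(e1, e2) \<in> orthonormal_frames \<Longrightarrow> plane_angle e1 e2 a \<in> {0..<pi}"
  using rmod_nonneg[of pi] rmod_less[of pi] by (auto simp: plane_angle_eq_arctan)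

lemma measurable_plane_angle:
  assumes "(e1, e2) \<in> orthonormal_frames"
  shows "plane_angle e1 e2 \<in> borel_measurable borel"
  unfolding plane_angle_eq_arctan[OF assms, abs_def] rmod_def
  by measurable

text \<open>
  The radius \<open>r\<close> may be negative, since the angle is only taken modulo \<open>\<pi>\<close>.  The bound on \<open>\<bar>r\<bar>\<close> is
  Bessel's inequality.  A vector orthogonal to the plane has \<open>r = 0\<close>, for which the default angle
  is harmless.
\<close>

lemma plane_angle_polar:
  assumes fr: "(e1, e2) \<in> orthonormal_frames" and a: "norm a = 1"
  obtains r where "\<bar>r\<bar> \<le> 1"
    "\<And>\<theta>. a \<bullet> fst (frame_rot \<theta> (e1, e2)) = r * cos (plane_angle e1 e2 a - \<theta>)"
    "\<And>\<theta>. a \<bullet> snd (frame_rot \<theta> (e1, e2)) = r * sin (plane_angle e1 e2 a - \<theta>)"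
    "plane_proj e1 e2 a \<noteq> 0 \<Longrightarrow> r \<noteq> 0"
proof -
  have fr': "e1 \<bullet> e1 = 1" "e2 \<bullet> e2 = 1" "e1 \<bullet> e2 = 0" "e2 \<bullet> e1 = 0"
    using fr by (auto simp: orthonormal_frames_iff inner_commute)
  have "\<exists>r. a \<bullet> e1 = r * cos (plane_angle e1 e2 a) \<and> a \<bullet> e2 = r * sin (plane_angle e1 e2 a)"
  proof (cases "plane_proj e1 e2 a = 0")
    case True
    then show ?thesis using plane_proj_eq_0_iff[OF fr] by (intro exI[of _ 0]) auto
  next
    case False
    let ?x = "a \<bullet> e1" and ?y = "a \<bullet> e2"
    obtain \<rho> s where \<rho>: "?x = \<rho> * cos s" "?y = \<rho> * sin s"
      using polar_Ex[of ?x ?y] by blast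
    let ?t = "s rmod pi"
    have "plane_angle e1 e2 a = ?t"
    proof (rule plane_angle_eqI[OF fr False])
      show "?t \<in> {0..<pi}" using rmod_nonneg[of pi s] rmod_less[of pi s] by auto
      have "sin (s - ?t) = 0" by (rule sin_diff_rmod_pi)
      then have "sin s * cos ?t = cos s * sin ?t" by (simp add: sin_diff)
      then show "?x * sin ?t = ?y * cos ?t" by (simp add: \<rho>)
    qed
    moreover have "sin (s - ?t) = 0" by (rule sin_diff_rmod_pi)
    then have "\<exists>\<epsilon>. cos s = \<epsilon> * cos ?t \<and> sin s = \<epsilon> * sin ?t"
      using cos_add[of "s - ?t" ?t] sin_add[of "s - ?t" ?t]
      by (intro exI[of _ "cos (s - ?t)"]) auto
    then obtain \<epsilon> where "cos s = \<epsilon> * cos ?t" "sin s = \<epsilon> * sin ?t" by blast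
    ultimately show ?thesis using \<rho> by (intro exI[of _ "\<rho> * \<epsilon>"]) simp
  qed
  then obtain r where r: "a \<bullet> e1 = r * cos (plane_angle e1 e2 a)" "a \<bullet> e2 = r * sin (plane_angle e1 e2 a)"
    by blast
  have "r\<^sup>2 = (a \<bullet> e1)\<^sup>2 + (a \<bullet> e2)\<^sup>2"
    unfolding r using sin_cos_squared_add[of "plane_angle e1 e2 a"]
    by (simp add: power_mult_distrib flip: distrib_left)
  also have "\<dots> \<le> 1"
  proof -
    have "0 \<le> (a - plane_proj e1 e2 a) \<bullet> (a - plane_proj e1 e2 a)" by (rule inner_ge_zero)
    also have "\<dots> = a \<bullet> a - ((a \<bullet> e1)\<^sup>2 + (a \<bullet> e2)\<^sup>2)"
      using fr' by (simp add: plane_proj_def inner_simps power2_eq_square inner_commute[of e1 a] inner_commute[of e2 a])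
    finally show ?thesis using a by (simp add: norm_eq_1)
  qed
  finally have "\<bar>r\<bar> \<le> 1" by (simp add: abs_square_le_1)
  moreover have "a \<bullet> fst (frame_rot \<theta> (e1, e2)) = r * cos (plane_angle e1 e2 a - \<theta>)" for \<theta>
    by (simp add: frame_rot_def inner_simps r cos_diff algebra_simps)
  moreover have "a \<bullet> snd (frame_rot \<theta> (e1, e2)) = r * sin (plane_angle e1 e2 a - \<theta>)" for \<theta>
    by (simp add: frame_rot_def inner_simps r sin_diff algebra_simps)
  moreover have "plane_proj e1 e2 a \<noteq> 0 \<Longrightarrow> r \<noteq> 0"
    using plane_proj_eq_0_iff[OF fr] r by auto
  ultimately show ?thesis using that by blast
qed

section \<open>Planes on which the field is integrable\<close>

lemma one_divide_ennreal_antimono: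
  assumes "0 \<le> x" "x \<le> y" shows "1 / ennreal y \<le> 1 / ennreal x"
proof (cases "x = 0")
  case False
  with assms show ?thesis
    by (auto simp: one_divide_ennreal intro!: ennreal_leI divide_left_mono)
qed simp

text \<open>
  Asking for almost every angle, and not for the angle \<open>0\<close>, makes this a property of the oriented
  plane rather than of the frame.
\<close>

definition good_frame :: "(real^'n) measure \<Rightarrow> (real^'n) \<times> (real^'n) \<Rightarrow> bool" where
  "good_frame \<mu> w \<longleftrightarrow> (AE \<theta> in lborel. I_fun \<mu> (fst (frame_rot \<theta> w)) < \<infinity>)"

context
  fixes \<mu> :: "(real^'n) measure"
  assumes prob_mu: "prob_space \<mu>"
    and sets_mu: "sets \<mu> = sets (restrict_space borel (sphere 0 1))"
begin

interpretation mu: prob_space \<mu> by (rule prob_mu)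

lemma space_mu: "space \<mu> = sphere 0 1"
  using sets_eq_imp_space_eq[OF sets_mu] by (simp add: space_restrict_space)

lemma measurable_mu: "f \<in> borel_measurable borel \<Longrightarrow> f \<in> borel_measurable \<mu>"
  using measurable_restrict_space1[of f borel borel "sphere 0 1"] measurable_cong_sets[OF sets_mu refl]
  by blast

lemma measurable_mu_id [measurable]: "(\<lambda>a. a) \<in> borel_measurable \<mu>"
  by (rule measurable_mu) simp

lemma measurable_I_fun [measurable]: "I_fun \<mu> \<in> borel_measurable borel"
proof -
  have [measurable]: "snd \<in> borel_measurable (borel \<Otimes>\<^sub>M \<mu>)"
    using measurable_compose[OF measurable_snd measurable_mu_id] .
  show ?thesis unfolding I_fun_def[abs_def] by measurable
qed

lemma measurable_g_fun [measurable]: "g_fun \<mu> \<in> borel_measurable borel"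
proof -
  have [measurable]: "snd \<in> borel_measurable (borel \<Otimes>\<^sub>M \<mu>)"
    using measurable_compose[OF measurable_snd measurable_mu_id] .
  show ?thesis unfolding g_fun_def[abs_def] by measurable
qed

lemma measurable_I_frame_rot [measurable]:
  assumes "\<theta> \<in> borel_measurable N" "g \<in> measurable N frame_space"
  shows "(\<lambda>x. I_fun \<mu> (fst (frame_rot (\<theta> x) (g x)))) \<in> borel_measurable N"
  by (intro measurable_compose[OF _ measurable_I_fun]
      measurable_compose[OF measurable_frame_rot[OF assms] measurable_frame_space_fst])

lemma measurable_I_frame_rot_const:
  assumes "w \<in> orthonormal_frames"
  shows "(\<lambda>\<theta>. I_fun \<mu> (fst (frame_rot \<theta> w))) \<in> borel_measurable borel"
  using assms by (intro measurable_I_frame_rot) (auto simp: space_frame_space)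

lemma good_frame_rot:
  assumes w: "w \<in> orthonormal_frames" and good: "good_frame \<mu> w"
  shows "good_frame \<mu> (frame_rot \<phi> w)"
proof -
  have "Measurable.pred borel (\<lambda>\<theta>. I_fun \<mu> (fst (frame_rot \<theta> w)) < \<infinity>)"
    using measurable_I_frame_rot_const[OF w] by measurable
  from AE_borel_affine[of 1, OF _ this good[unfolded good_frame_def], of \<phi>]
  show ?thesis by (simp add: good_frame_def frame_rot_add add.commute)
qed

text \<open>
  The condition says that the set of bad angles has measure zero, and this measure depends
  measurably on the frame.
\<close>

lemma pred_good_frame: "{w \<in> orthonormal_frames. good_frame \<mu> w} \<in> sets frame_space"
proof -
  have eq: "good_frame \<mu> w \<longleftrightarrow> (\<integral>\<^sup>+\<theta>. indicator {\<infinity>} (I_fun \<mu> (fst (frame_rot \<theta> w))) \<partial>lborel) = 0"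
    if "w \<in> orthonormal_frames" for w
    unfolding good_frame_def using measurable_I_frame_rot_const[OF that]
    by (subst nn_integral_0_iff_AE) (auto simp: less_top indicator_eq_0_iff)
  have "(\<lambda>w. \<integral>\<^sup>+\<theta>. indicator {\<infinity>} (I_fun \<mu> (fst (frame_rot \<theta> w))) \<partial>lborel) \<in> borel_measurable frame_space"
    by measurable
  then have "{w \<in> space frame_space. (\<integral>\<^sup>+\<theta>. indicator {\<infinity>} (I_fun \<mu> (fst (frame_rot \<theta> w))) \<partial>lborel) = 0} \<in> sets frame_space"
    by measurable
  also have "{w \<in> space frame_space. (\<integral>\<^sup>+\<theta>. indicator {\<infinity>} (I_fun \<mu> (fst (frame_rot \<theta> w))) \<partial>lborel) = 0}
      = {w \<in> orthonormal_frames. good_frame \<mu> w}"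
    using eq by (auto simp: space_frame_space)
  finally show ?thesis .
qed

lemma plane_angle_measurable_mu:
  "(e1, e2) \<in> orthonormal_frames \<Longrightarrow> plane_angle e1 e2 \<in> borel_measurable \<mu>"
  by (rule measurable_mu[OF measurable_plane_angle])

text \<open>
  Because \<open>\<bar>r\<bar> \<le> 1\<close>, replacing \<open>a\<close> by the direction of its projection can only decrease
  \<open>1 / \<bar>a \<bullet> u\<bar>\<close>.
\<close>

lemma secant_integral_le_I_fun:
  assumes fr: "(e1, e2) \<in> orthonormal_frames"
  shows "(\<integral>\<^sup>+a. 1 / ennreal \<bar>cos (plane_angle e1 e2 a - \<theta>)\<bar> \<partial>\<mu>) \<le> I_fun \<mu> (fst (frame_rot \<theta> (e1, e2)))"
  unfolding I_fun_def
proof (rule nn_integral_mono)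
  fix a assume "a \<in> space \<mu>"
  then have a: "norm a = 1" by (simp add: space_mu)
  obtain r where "\<bar>r\<bar> \<le> 1" "a \<bullet> fst (frame_rot \<theta> (e1, e2)) = r * cos (plane_angle e1 e2 a - \<theta>)"
    using plane_angle_polar[OF fr a] by metis
  then show "1 / ennreal \<bar>cos (plane_angle e1 e2 a - \<theta>)\<bar> \<le> 1 / ennreal \<bar>a \<bullet> fst (frame_rot \<theta> (e1, e2))\<bar>"
    by (intro one_divide_ennreal_antimono) (auto simp: abs_mult intro: mult_left_le_one_le)
qed

lemma AE_inner_nonzero:
  assumes "I_fun \<mu> u < \<infinity>" shows "AE a in \<mu>. a \<bullet> u \<noteq> 0"
proof -
  have "(\<lambda>a. 1 / ennreal \<bar>a \<bullet> u\<bar>) \<in> borel_measurable \<mu>"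
    by measurable
  then have "AE a in \<mu>. 1 / ennreal \<bar>a \<bullet> u\<bar> \<noteq> \<infinity>"
    using assms by (intro nn_integral_noteq_infinite) (auto simp: less_top I_fun_def)
  then show ?thesis by eventually_elim auto
qed

lemma integrable_field:
  assumes fin: "I_fun \<mu> u < \<infinity>" shows "integrable \<mu> (\<lambda>a. (1 / (a \<bullet> u)) *\<^sub>R a)"
proof (rule integrableI_bounded)
  have "(\<integral>\<^sup>+a. ennreal (norm ((1 / (a \<bullet> u)) *\<^sub>R a)) \<partial>\<mu>) = I_fun \<mu> u"
    unfolding I_fun_def
  proof (rule nn_integral_cong_AE)
    show "AE a in \<mu>. ennreal (norm ((1 / (a \<bullet> u)) *\<^sub>R a)) = 1 / ennreal \<bar>a \<bullet> u\<bar>"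
      using AE_inner_nonzero[OF fin] AE_space
      by eventually_elim (simp add: space_mu one_divide_ennreal)
  qed
  then show "(\<integral>\<^sup>+a. ennreal (norm ((1 / (a \<bullet> u)) *\<^sub>R a)) \<partial>\<mu>) < \<infinity>" using fin by simp
qed measurable

text \<open>
  The unknown radius cancels in the quotient of the two polar formulas.
\<close>

lemma field_component_eq_tan_integral:
  assumes fr: "(e1, e2) \<in> orthonormal_frames"
    and fin: "I_fun \<mu> (fst (frame_rot \<theta> (e1, e2))) < \<infinity>"
  shows "g_fun \<mu> (fst (frame_rot \<theta> (e1, e2))) \<bullet> snd (frame_rot \<theta> (e1, e2)) =
    (\<integral>a. tan (plane_angle e1 e2 a - \<theta>) \<partial>\<mu>)"
proof -
  let ?u = "fst (frame_rot \<theta> (e1, e2))" and ?v = "snd (frame_rot \<theta> (e1, e2))"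
  note [measurable] = plane_angle_measurable_mu[OF fr]
  have "g_fun \<mu> ?u \<bullet> ?v = (\<integral>a. ((1 / (a \<bullet> ?u)) *\<^sub>R a) \<bullet> ?v \<partial>\<mu>)"
    unfolding g_fun_def by (rule integral_inner_left[symmetric]) (rule integrable_field[OF fin])
  also have "\<dots> = (\<integral>a. tan (plane_angle e1 e2 a - \<theta>) \<partial>\<mu>)"
  proof (rule integral_cong_AE)
    show "AE a in \<mu>. ((1 / (a \<bullet> ?u)) *\<^sub>R a) \<bullet> ?v = tan (plane_angle e1 e2 a - \<theta>)"
      using AE_inner_nonzero[OF fin] AE_space
    proof eventually_elim
      fix a assume ne: "a \<bullet> ?u \<noteq> 0" and "a \<in> space \<mu>"
      then have a: "norm a = 1" by (simp add: space_mu)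
      obtain r where r: "a \<bullet> ?u = r * cos (plane_angle e1 e2 a - \<theta>)" "a \<bullet> ?v = r * sin (plane_angle e1 e2 a - \<theta>)"
        using plane_angle_polar[OF fr a] by metis
      show "((1 / (a \<bullet> ?u)) *\<^sub>R a) \<bullet> ?v = tan (plane_angle e1 e2 a - \<theta>)"
        using ne unfolding inner_scaleR_left r by (simp add: tan_def)
    qed
    show "(\<lambda>a. tan (plane_angle e1 e2 a - \<theta>)) \<in> borel_measurable \<mu>"
      unfolding tan_def by measurable
  qed measurable
  finally show ?thesis .
qed

lemma field_component_cauchy:
  assumes w: "w \<in> orthonormal_frames" and good: "good_frame \<mu> w"
  shows "distr unif01 borel (\<lambda>s. g_fun \<mu> (fst (frame_rot (pi * s) w)) \<bullet> snd (frame_rot (pi * s) w)) = cauchy_distribution 0 1"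
proof -
  obtain e1 e2 where we: "w = (e1, e2)" by (cases w)
  with w have fr: "(e1, e2) \<in> orthonormal_frames" by simp
  note angle = plane_angle_measurable_mu[OF fr]
  have "Measurable.pred borel (\<lambda>\<theta>. I_fun \<mu> (fst (frame_rot \<theta> w)) < \<infinity>)"
    using measurable_I_frame_rot_const[OF w] by measurable
  from AE_borel_affine[of pi, OF _ this good[unfolded good_frame_def], of 0]
  have fin: "AE s in unif01. I_fun \<mu> (fst (frame_rot (pi * s) w)) < \<infinity>"
    by (intro AE_unif01) simp
  then have "AE s in unif01. (\<integral>\<^sup>+a. 1 / ennreal \<bar>cos (plane_angle e1 e2 a - pi * s)\<bar> \<partial>\<mu>) < \<infinity>"
    unfolding we by eventually_elim (rule le_less_trans[OF secant_integral_le_I_fun[OF fr]])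
  from tan_transform_cauchy[OF prob_mu angle this]
  have "distr unif01 borel (\<lambda>s. \<integral>a. tan (plane_angle e1 e2 a - pi * s) \<partial>\<mu>) = cauchy_distribution 0 1" .
  moreover have "distr unif01 borel (\<lambda>s. g_fun \<mu> (fst (frame_rot (pi * s) w)) \<bullet> snd (frame_rot (pi * s) w))
      = distr unif01 borel (\<lambda>s. \<integral>a. tan (plane_angle e1 e2 a - pi * s) \<partial>\<mu>)"
  proof (rule distr_cong_AE)
    show "AE s in unif01. g_fun \<mu> (fst (frame_rot (pi * s) w)) \<bullet> snd (frame_rot (pi * s) w) =
        (\<integral>a. tan (plane_angle e1 e2 a - pi * s) \<partial>\<mu>)"
      using fin unfolding we by eventually_elim (rule field_component_eq_tan_integral[OF fr])
    show "(\<lambda>s. g_fun \<mu> (fst (frame_rot (pi * s) w)) \<bullet> snd (frame_rot (pi * s) w)) \<in> measurable unif01 borel"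
      unfolding frame_rot_def by measurable
    show "(\<lambda>s. \<integral>a. tan (plane_angle e1 e2 a - pi * s) \<partial>\<mu>) \<in> measurable unif01 borel"
      using measurable_tan_transform[OF prob_mu angle] by (simp cong: measurable_cong_sets)
  qed auto
  ultimately show ?thesis by simp
qed

text \<open>
  A single good angle suffices: \<open>1 / \<bar>a \<bullet> u\<bar>\<close> is infinite on the orthogonal complement of the plane.
\<close>

lemma good_frame_orthogonal_comp_null:
  assumes w: "(e1, e2) \<in> orthonormal_frames" and good: "good_frame \<mu> (e1, e2)"
  shows "emeasure \<mu> (orthogonal_comp (span {e1, e2}) \<inter> sphere 0 1) = 0"
proof -
  obtain \<theta> where "I_fun \<mu> (fst (frame_rot \<theta> (e1, e2))) < \<infinity>"
  proof (rule ccontr)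
    assume "\<not> thesis"
    then have "AE \<theta> :: real in lborel. False"
      using good that unfolding good_frame_def by (auto elim: eventually_mono)
    then have "emeasure (lborel :: real measure) {\<theta> \<in> space lborel. True} = 0"
      by (intro emeasure_eq_0_AE) simp
    then show False by simp
  qed
  then have "AE a in \<mu>. a \<bullet> fst (frame_rot \<theta> (e1, e2)) \<noteq> 0" by (rule AE_inner_nonzero)
  then have null: "emeasure \<mu> {a \<in> space \<mu>. a \<bullet> fst (frame_rot \<theta> (e1, e2)) = 0} = 0"
    by (intro emeasure_eq_0_AE) simp
  have "fst (frame_rot \<theta> (e1, e2)) \<in> span {e1, e2}"
    using span_frame_rot_le[of \<theta> "(e1, e2)"] span_base[of "fst (frame_rot \<theta> (e1, e2))"] by auto
  then have "orthogonal_comp (span {e1, e2}) \<inter> sphere 0 1 \<subseteq> {a \<in> space \<mu>. a \<bullet> fst (frame_rot \<theta> (e1, e2)) = 0}"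
    by (auto simp: orthogonal_comp_def orthogonal_def space_mu inner_commute)
  then have "emeasure \<mu> (orthogonal_comp (span {e1, e2}) \<inter> sphere 0 1) \<le>
      emeasure \<mu> {a \<in> space \<mu>. a \<bullet> fst (frame_rot \<theta> (e1, e2)) = 0}"
    by (rule emeasure_mono) measurable
  with null show ?thesis by simp
qed

lemma angle_measurable_circle:
  assumes "(e1, e2) \<in> orthonormal_frames"
  shows "plane_angle e1 e2 \<in> measurable \<mu> circle_mod_pi"
  unfolding circle_mod_pi_def
  using plane_angle_measurable_mu[OF assms] plane_angle_range[OF assms]
  by (intro measurable_restrict_space2) auto

lemma prob_space_angular_pushforward:
  "(e1, e2) \<in> orthonormal_frames \<Longrightarrow> prob_space (angular_pushforward \<mu> e1 e2)"
  unfolding angular_pushforward_def by (intro mu.prob_space_distr angle_measurable_circle)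

text \<open>
  The separating set consists of the \<open>x\<close> at which the vector of angle \<open>x + \<pi> / 2\<close> has finite \<open>I_fun\<close>.
  There \<open>\<bar>a \<bullet> u\<bar> = \<bar>r sin (\<alpha> - x)\<bar> \<le> \<bar>\<alpha> - x\<bar>\<close>, so the potential of the pushforward at \<open>x\<close> is finite.
\<close>

lemma good_frame_angular_pushforward_singular:
  assumes fr: "(e1, e2) \<in> orthonormal_frames" and good: "good_frame \<mu> (e1, e2)"
  shows "mutually_singular (angular_pushforward \<mu> e1 e2) lebesgue_mod_pi"
proof -
  let ?t = "plane_angle e1 e2"
  define J where "J = (\<lambda>x. I_fun \<mu> (fst (frame_rot (x + pi / 2) (e1, e2))))"
  have J [measurable]: "J \<in> borel_measurable borel"
    unfolding J_def using fr by (intro measurable_I_frame_rot) (auto simp: space_frame_space)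
  note angle [measurable] = plane_angle_measurable_mu[OF fr]
  define A where "A = {x \<in> {0..<pi}. J x < \<infinity>}"
  have A [measurable]: "A \<in> sets borel" unfolding A_def by measurable
  have A_sub: "A \<subseteq> {0..<pi}" by (auto simp: A_def)
  have "emeasure (distr \<mu> borel ?t) A = 0"
  proof (rule null_set_of_finite_potential)
    show "bounded A" by (rule bounded_subset[of "{0..pi}"]) (auto simp: A_def)
    fix x assume "x \<in> A"
    have "(\<integral>\<^sup>+t. 1 / ennreal \<bar>t - x\<bar> \<partial>distr \<mu> borel ?t) = (\<integral>\<^sup>+a. 1 / ennreal \<bar>?t a - x\<bar> \<partial>\<mu>)"
      by (rule nn_integral_distr) measurable
    also have "\<dots> \<le> J x"
      unfolding J_def I_fun_def
    proof (rule nn_integral_mono)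
      fix a assume "a \<in> space \<mu>"
      then have a: "norm a = 1" by (simp add: space_mu)
      obtain r where r: "\<bar>r\<bar> \<le> 1" "a \<bullet> fst (frame_rot (x + pi / 2) (e1, e2)) = r * cos (?t a - (x + pi / 2))"
        using plane_angle_polar[OF fr a] by metis
      have "cos (?t a - (x + pi / 2)) = sin (?t a - x)"
        by (simp add: cos_diff sin_diff cos_add sin_add)
      then have "\<bar>a \<bullet> fst (frame_rot (x + pi / 2) (e1, e2))\<bar> = \<bar>r\<bar> * \<bar>sin (?t a - x)\<bar>"
        by (simp add: r(2) abs_mult)
      also have "\<dots> \<le> 1 * \<bar>?t a - x\<bar>"
        using r(1) by (intro mult_mono abs_sin_x_le_abs_x) auto
      finally show "1 / ennreal \<bar>?t a - x\<bar> \<le> 1 / ennreal \<bar>a \<bullet> fst (frame_rot (x + pi / 2) (e1, e2))\<bar>"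
        by (intro one_divide_ennreal_antimono) auto
    qed
    also have "\<dots> < \<infinity>" using \<open>x \<in> A\<close> by (simp add: A_def)
    finally show "(\<integral>\<^sup>+t. 1 / ennreal \<bar>t - x\<bar> \<partial>distr \<mu> borel ?t) < \<infinity>" .
  qed auto
  then have nuA: "emeasure (angular_pushforward \<mu> e1 e2) A = 0"
    using angle_measurable_circle[OF fr] A A_sub unfolding angular_pushforward_def
    by (simp add: emeasure_distr circle_mod_pi_def sets_restrict_space_iff)
  have "Measurable.pred borel (\<lambda>\<theta>. I_fun \<mu> (fst (frame_rot \<theta> (e1, e2))) < \<infinity>)"
    using measurable_I_frame_rot_const[OF fr] by measurable
  from AE_borel_affine[of 1, OF _ this good[unfolded good_frame_def], of "pi / 2"]
  have "AE x in lborel. J x < \<infinity>" by (simp add: J_def add.commute)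
  then have "AE x in lborel. \<not> x \<in> {0..<pi} - A"
    by eventually_elim (simp add: A_def)
  then have "emeasure lborel {x \<in> space lborel. x \<in> {0..<pi} - A} = 0"
    by (rule emeasure_eq_0_AE)
  then have "emeasure lborel ({0..<pi} - A) = 0"
    by (simp only: space_lborel space_borel UNIV_I simp_thms Collect_mem_eq)
  then have "emeasure lebesgue_mod_pi ({0..<pi} - A) = 0"
    unfolding lebesgue_mod_pi_def by (subst emeasure_restrict_space) auto
  moreover have "space lebesgue_mod_pi = {0..<pi}"
    by (simp add: lebesgue_mod_pi_def space_restrict_space)
  moreover have "sets (angular_pushforward \<mu> e1 e2) = sets lebesgue_mod_pi"
    unfolding angular_pushforward_def circle_mod_pi_def lebesgue_mod_pi_def sets_distr
    by (rule sets_restrict_space_cong) simp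
  moreover have "A \<in> sets (angular_pushforward \<mu> e1 e2)"
    using A A_sub by (simp add: angular_pushforward_def circle_mod_pi_def sets_restrict_space_iff)
  ultimately show ?thesis
    unfolding mutually_singular_def using nuA by auto
qed

end

section \<open>Disintegration over the plane\<close>

text \<open>
  Two right-continuous functions that differ at a point differ on an interval to its right,
  which contains a rational number.
\<close>

lemma real_distribution_eqI_rational_cdf:
  assumes M1: "real_distribution M1" and M2: "real_distribution M2"
    and eq: "\<And>q. q \<in> \<rat> \<Longrightarrow> measure M1 {..q} = measure M2 {..q}"
  shows "M1 = M2"
proof (rule cdf_unique[OF M1 M2], rule ext)
  interpret M1: real_distribution M1 by fact
  interpret M2: real_distribution M2 by fact
  fix x :: real
  show "cdf M1 x = cdf M2 x"
  proof (rule ccontr)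
    assume "cdf M1 x \<noteq> cdf M2 x"
    moreover have "((\<lambda>y. cdf M1 y - cdf M2 y) \<longlongrightarrow> cdf M1 x - cdf M2 x) (at_right x)"
      using M1.cdf_is_right_cont[of x] M2.cdf_is_right_cont[of x]
      by (intro tendsto_diff) (auto simp: continuous_within)
    ultimately have "eventually (\<lambda>y. cdf M1 y - cdf M2 y \<noteq> 0) (at_right x)"
      by (intro tendsto_imp_eventually_ne) auto
    then obtain b where b: "x < b" "\<And>y. x < y \<Longrightarrow> y < b \<Longrightarrow> cdf M1 y - cdf M2 y \<noteq> 0"
      by (auto simp: eventually_at_right[OF less_add_one])
    obtain q where "q \<in> \<rat>" "x < q" "q < b" using Rats_dense_in_real[OF b(1)] by blast
    with b(2)[of q] eq[of q] show False by (simp add: cdf_def)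
  qed
qed

lemma prob_space_cauchy_distribution: "prob_space (cauchy_distribution 0 1)"
proof -
  interpret u: prob_space unif01 by (rule prob_space_unif01)
  have "(\<lambda>s. tan (pi / 2 - pi * s)) \<in> measurable unif01 borel"
    unfolding tan_def by measurable
  then show ?thesis unfolding cauchy_distribution_eq_tan_uniform by (rule u.prob_space_distr)
qed

lemma sets_cauchy_distribution [simp]: "sets (cauchy_distribution x \<gamma>) = sets borel"
  by (simp add: cauchy_distribution_def)

text \<open>
  For each fixed angle the rotated first vector has law \<open>\<sigma>\<close>, so \<open>I_fun\<close> is finite there almost
  surely; exchange the quantifiers over angles and outcomes by Fubini.
\<close>

lemma haar_frame_good:
  assumes prob_mu: "prob_space \<mu>" and sets_mu: "sets \<mu> = sets (restrict_space borel (sphere 0 1))"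
    and \<sigma>: "haar_sphere \<sigma>" and fin: "AE u in \<sigma>. I_fun \<mu> u < \<infinity>"
    and UV: "haar_two_frame M U V"
  shows "AE \<omega> in M. good_frame \<mu> (U \<omega>, V \<omega>)"
proof -
  interpret M: prob_space M using UV by (simp add: haar_two_frame_def)
  interpret L: pair_sigma_finite lborel M ..
  have fr: "(\<lambda>\<omega>. (U \<omega>, V \<omega>)) \<in> measurable M frame_space"
    using UV by (simp add: haar_two_frame_def)
  note I [measurable] = measurable_I_fun[OF prob_mu sets_mu]
  let ?J = "\<lambda>\<theta> \<omega>. I_fun \<mu> (fst (frame_rot \<theta> (U \<omega>, V \<omega>)))"
  have joint: "(\<lambda>x. ?J (fst x) (snd x)) \<in> borel_measurable (lborel \<Otimes>\<^sub>M M)"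
    by (intro measurable_I_frame_rot[OF prob_mu sets_mu] measurable_compose[OF measurable_snd fr]) measurable
  have "AE \<omega> in M. ?J \<theta> \<omega> < \<infinity>" for \<theta>
  proof -
    have "(\<integral>\<^sup>+\<omega>. indicator {\<infinity>} (?J \<theta> \<omega>) \<partial>M) = (\<integral>\<^sup>+\<omega>. indicator {\<infinity>} (I_fun \<mu> (U \<omega>)) \<partial>M)"
    proof -
      have "(\<lambda>w. indicator {\<infinity>} (I_fun \<mu> (fst w)) :: ennreal) \<in> borel_measurable frame_space"
        by measurable
      from haar_two_frame_rotation_invariant[OF UV this] show ?thesis by simp
    qed
    also have "\<dots> = (\<integral>\<^sup>+u. indicator {\<infinity>} (I_fun \<mu> u) \<partial>\<sigma>)"
      by (rule haar_two_frame_first_vector[OF UV \<sigma>]) measurable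
    also have "\<dots> = (\<integral>\<^sup>+u. 0 \<partial>\<sigma>)"
      using fin by (intro nn_integral_cong_AE) (auto elim: eventually_mono)
    finally have "(\<integral>\<^sup>+\<omega>. indicator {\<infinity>} (?J \<theta> \<omega>) \<partial>M) = 0" by simp
    moreover have [measurable]: "(\<lambda>\<omega>. ?J \<theta> \<omega>) \<in> borel_measurable M"
      by (intro measurable_I_frame_rot[OF prob_mu sets_mu] fr) measurable
    ultimately have "AE \<omega> in M. indicator {\<infinity>} (?J \<theta> \<omega>) = (0::ennreal)"
      by (subst (asm) nn_integral_0_iff_AE) measurable
    then show ?thesis by eventually_elim (auto simp: less_top indicator_eq_0_iff)
  qed
  then have "AE \<theta> in lborel. AE \<omega> in M. ?J \<theta> \<omega> < \<infinity>" by simp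
  then have "AE \<omega> in M. AE \<theta> in lborel. ?J \<theta> \<omega> < \<infinity>"
    using measurable_sets[OF joint, of "{..<\<infinity>}"]
    by (subst (asm) L.AE_commute) (simp_all add: vimage_def Int_def conj_commute)
  then show ?thesis by (simp add: good_frame_def)
qed

text \<open>
  Goodness does not change when a frame is rotated in its plane, so the preimage in the space of
  frames is the set of good frames.
\<close>

lemma good_planes_measurable:
  assumes prob_mu: "prob_space \<mu>" and sets_mu: "sets \<mu> = sets (restrict_space borel (sphere 0 1))"
  shows "{Q \<in> space oriented_planes. \<forall>w \<in> Q. good_frame \<mu> w} \<in> sets oriented_planes"
proof (rule sets_oriented_planesI)
  have "{w \<in> orthonormal_frames. oriented_span (fst w) (snd w) \<in> {Q \<in> space oriented_planes. \<forall>w \<in> Q. good_frame \<mu> w}}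
      = {w \<in> orthonormal_frames. good_frame \<mu> w}"
  proof (intro set_eqI iffI; clarsimp)
    fix u v :: "real^'a"
    assume uv: "(u, v) \<in> orthonormal_frames"
    show "good_frame \<mu> (u, v)" if "\<forall>w \<in> oriented_span u v. good_frame \<mu> w"
      using that in_oriented_span_self[OF uv] by blast
    assume good: "good_frame \<mu> (u, v)"
    have "good_frame \<mu> w" if w: "w \<in> oriented_span u v" for w
    proof -
      obtain \<theta> where "w = frame_rot \<theta> (u, v)"
        using oriented_span_is_orbit[OF uv, of "fst w" "snd w"] w by auto
      then show ?thesis using good_frame_rot[OF prob_mu sets_mu uv good] by simp
    qed
    moreover have "oriented_span u v \<in> space oriented_planes"
      using uv by (auto simp: space_oriented_planes)
    ultimately show "oriented_span u v \<in> space oriented_planes \<and> (\<forall>w \<in> oriented_span u v. good_frame \<mu> w)"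
      by blast
  qed
  then show "{w \<in> orthonormal_frames. oriented_span (fst w) (snd w) \<in> {Q \<in> space oriented_planes. \<forall>w \<in> Q. good_frame \<mu> w}}
      \<in> sets frame_space"
    using pred_good_frame[OF prob_mu sets_mu] by simp
qed auto

text \<open>
  Replace the frame by its rotation through \<open>\<pi> s\<close> and average over \<open>s\<close>.  The plane stays fixed,
  and the average over \<open>s\<close> of the indicator of \<open>B\<close> is the Cauchy mass of \<open>B\<close> for every good frame.
\<close>

lemma plane_and_field_independent:
  assumes prob_mu: "prob_space \<mu>" and sets_mu: "sets \<mu> = sets (restrict_space borel (sphere 0 1))"
    and \<sigma>: "haar_sphere \<sigma>" and fin: "AE u in \<sigma>. I_fun \<mu> u < \<infinity>"
    and UV: "haar_two_frame M U V"
    and S: "S \<in> sets oriented_planes" and B [measurable]: "B \<in> sets borel"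
  shows "(\<integral>\<^sup>+\<omega>. indicator S (oriented_span (U \<omega>) (V \<omega>)) * indicator B (g_fun \<mu> (U \<omega>) \<bullet> V \<omega>) \<partial>M) =
    emeasure (cauchy_distribution 0 1) B * (\<integral>\<^sup>+\<omega>. indicator S (oriented_span (U \<omega>) (V \<omega>)) \<partial>M)"
proof -
  interpret M: prob_space M using UV by (simp add: haar_two_frame_def)
  interpret u: prob_space unif01 by (rule prob_space_unif01)
  interpret L: pair_sigma_finite unif01 M ..
  have fr: "(\<lambda>\<omega>. (U \<omega>, V \<omega>)) \<in> measurable M frame_space"
    using UV by (simp add: haar_two_frame_def)
  note [measurable] = measurable_g_fun[OF prob_mu sets_mu]
  have [measurable]: "(\<lambda>w. indicator S (oriented_span (fst w) (snd w)) :: ennreal) \<in> borel_measurable frame_space"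
    by (rule measurable_compose[OF measurable_oriented_span borel_measurable_indicator[OF S]])
  have [measurable]: "(\<lambda>w. indicator B (g_fun \<mu> (fst w) \<bullet> snd w) :: ennreal) \<in> borel_measurable frame_space"
    by measurable
  define f :: "(real^'a) \<times> (real^'a) \<Rightarrow> ennreal" where
    "f = (\<lambda>w. indicator S (oriented_span (fst w) (snd w)) * indicator B (g_fun \<mu> (fst w) \<bullet> snd w))"
  have f: "f \<in> borel_measurable frame_space" unfolding f_def by measurable
  have "(\<integral>\<^sup>+\<omega>. f (U \<omega>, V \<omega>) \<partial>M) = (\<integral>\<^sup>+s. \<integral>\<^sup>+\<omega>. f (U \<omega>, V \<omega>) \<partial>M \<partial>unif01)"
    using u.emeasure_space_1 by simp
  also have "\<dots> = (\<integral>\<^sup>+s. \<integral>\<^sup>+\<omega>. f (frame_rot (pi * s) (U \<omega>, V \<omega>)) \<partial>M \<partial>unif01)"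
    by (simp only: haar_two_frame_rotation_invariant[OF UV f])
  also have "\<dots> = (\<integral>\<^sup>+\<omega>. \<integral>\<^sup>+s. f (frame_rot (pi * s) (U \<omega>, V \<omega>)) \<partial>unif01 \<partial>M)"
  proof (rule L.Fubini'[symmetric])
    show "(\<lambda>(s, \<omega>). f (frame_rot (pi * s) (U \<omega>, V \<omega>))) \<in> borel_measurable (unif01 \<Otimes>\<^sub>M M)"
      unfolding case_prod_unfold
      by (intro measurable_compose[OF measurable_frame_rot f] measurable_compose[OF measurable_snd fr]) measurable
  qed
  also have "\<dots> = (\<integral>\<^sup>+\<omega>. emeasure (cauchy_distribution 0 1) B * indicator S (oriented_span (U \<omega>) (V \<omega>)) \<partial>M)"
  proof (rule nn_integral_cong_AE)
    show "AE \<omega> in M. (\<integral>\<^sup>+s. f (frame_rot (pi * s) (U \<omega>, V \<omega>)) \<partial>unif01) =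
        emeasure (cauchy_distribution 0 1) B * indicator S (oriented_span (U \<omega>) (V \<omega>))"
      using haar_frame_good[OF prob_mu sets_mu \<sigma> fin UV] AE_space
    proof eventually_elim
      fix \<omega> assume good: "good_frame \<mu> (U \<omega>, V \<omega>)" and "\<omega> \<in> space M"
      then have w: "(U \<omega>, V \<omega>) \<in> orthonormal_frames"
        using measurable_space[OF fr] by (simp add: space_frame_space)
      define Z where "Z = (\<lambda>s. g_fun \<mu> (fst (frame_rot (pi * s) (U \<omega>, V \<omega>))) \<bullet> snd (frame_rot (pi * s) (U \<omega>, V \<omega>)))"
      have Z [measurable]: "Z \<in> measurable unif01 borel"
        unfolding Z_def frame_rot_def by measurable
      have "(\<integral>\<^sup>+s. f (frame_rot (pi * s) (U \<omega>, V \<omega>)) \<partial>unif01) =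
          (\<integral>\<^sup>+s. indicator S (oriented_span (U \<omega>) (V \<omega>)) * indicator B (Z s) \<partial>unif01)"
        unfolding f_def oriented_span_frame_rot Z_def by simp
      also have "\<dots> = indicator S (oriented_span (U \<omega>) (V \<omega>)) * (\<integral>\<^sup>+s. indicator B (Z s) \<partial>unif01)"
        by (rule nn_integral_cmult) measurable
      also have "(\<integral>\<^sup>+s. indicator B (Z s) \<partial>unif01) = (\<integral>\<^sup>+x. indicator B x \<partial>distr unif01 borel Z)"
        by (rule nn_integral_distr[symmetric]) measurable
      also have "\<dots> = emeasure (cauchy_distribution 0 1) B"
        using field_component_cauchy[OF prob_mu sets_mu w good] by (simp add: Z_def)
      finally show "(\<integral>\<^sup>+s. f (frame_rot (pi * s) (U \<omega>, V \<omega>)) \<partial>unif01) =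
          emeasure (cauchy_distribution 0 1) B * indicator S (oriented_span (U \<omega>) (V \<omega>))"
        by (simp add: mult.commute)
    qed
  qed
  also have "\<dots> = emeasure (cauchy_distribution 0 1) B * (\<integral>\<^sup>+\<omega>. indicator S (oriented_span (U \<omega>) (V \<omega>)) \<partial>M)"
    by (rule nn_integral_cmult)
       (use measurable_compose[OF measurable_compose[OF fr measurable_oriented_span] borel_measurable_indicator[OF S]] in simp)
  finally show ?thesis by (simp add: f_def)
qed

text \<open>
  The events of the sigma-algebra generated by \<open>Y\<close> are the preimages under \<open>Y\<close>, so the assumption
  is the defining property of a conditional probability equal to \<open>c\<close>.
\<close>

lemma real_cond_exp_indep_indicator:
  assumes M: "prob_space M" and X [measurable]: "X \<in> borel_measurable M" and Y: "Y \<in> measurable M N"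
    and B [measurable]: "B \<in> sets borel"
    and indep: "\<And>S. S \<in> sets N \<Longrightarrow>
      (\<integral>\<^sup>+\<omega>. indicator S (Y \<omega>) * indicator B (X \<omega>) \<partial>M) = ennreal c * (\<integral>\<^sup>+\<omega>. indicator S (Y \<omega>) \<partial>M)"
    and c: "0 \<le> c"
  shows "AE \<omega> in M. real_cond_exp M (vimage_algebra (space M) Y N) (\<lambda>\<omega>'. indicator B (X \<omega>')) \<omega> = c"
proof -
  interpret M: prob_space M by fact
  let ?F = "vimage_algebra (space M) Y N"
  have YF: "Y \<in> space M \<rightarrow> space N" using measurable_space[OF Y] by auto
  have F: "A \<in> sets ?F \<longleftrightarrow> (\<exists>S \<in> sets N. A = Y -` S \<inter> space M)" for A
    unfolding sets_vimage_algebra2[OF YF] by auto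
  have "subalgebra M ?F"
    unfolding subalgebra_def using measurable_sets[OF Y] F by auto
  then interpret finite_measure_subalgebra M ?F
    by unfold_locales
  show ?thesis
  proof (rule real_cond_exp_charact)
    fix A assume "A \<in> sets ?F"
    then obtain S where S: "S \<in> sets N" "A = Y -` S \<inter> space M" using F by blast
    have A [measurable]: "A \<in> sets M" using S measurable_sets[OF Y] by simp
    have "ennreal (\<integral>\<omega>. indicator A \<omega> * indicator B (X \<omega>) \<partial>M) = (\<integral>\<^sup>+\<omega>. ennreal (indicator A \<omega> * indicator B (X \<omega>)) \<partial>M)"
      by (rule nn_integral_eq_integral[symmetric])
         (auto intro!: M.integrable_const_bound[of _ 1] simp: indicator_def)
    also have "\<dots> = (\<integral>\<^sup>+\<omega>. indicator S (Y \<omega>) * indicator B (X \<omega>) \<partial>M)"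
      by (rule nn_integral_cong) (auto simp: S(2) indicator_def)
    also have "\<dots> = ennreal c * (\<integral>\<^sup>+\<omega>. indicator S (Y \<omega>) \<partial>M)" by (rule indep[OF S(1)])
    also have "(\<integral>\<^sup>+\<omega>. indicator S (Y \<omega>) \<partial>M) = (\<integral>\<^sup>+\<omega>. indicator A \<omega> \<partial>M)"
      by (rule nn_integral_cong) (auto simp: S(2) indicator_def)
    also have "ennreal c * \<dots> = ennreal (c * measure M A)"
      using c by (simp add: M.emeasure_eq_measure ennreal_mult)
    finally have "(\<integral>\<omega>. indicator A \<omega> * indicator B (X \<omega>) \<partial>M) = c * measure M A"
      using c by (subst (asm) ennreal_inj) (auto intro!: integral_nonneg_AE)
    then show "(\<integral>\<omega>\<in>A. indicator B (X \<omega>) \<partial>M) = (\<integral>\<omega>\<in>A. c \<partial>M)"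
      by (simp add: set_lebesgue_integral_def mult.commute)
  next
    show "integrable M (\<lambda>\<omega>. indicator B (X \<omega>) :: real)"
      by (rule M.integrable_const_bound[of _ 1]) (auto simp: indicator_def)
  qed auto
qed

theorem proposition7p2:
  fixes \<mu> \<sigma> :: "(real^'n) measure"
    and M :: "'w measure"
    and U V :: "'w \<Rightarrow> real^'n"
  assumes p_ge_2: "CARD('n) \<ge> 2"
    and prob_mu: "prob_space \<mu>"
    and sets_mu: "sets \<mu> = sets (restrict_space borel (sphere 0 1))"
    and haar_sigma: "haar_sphere \<sigma>"
    and I_finite: "AE u in \<sigma>. I_fun \<mu> u < \<infinity>"
    and haar_UV: "haar_two_frame M U V"
  shows
    "let P = (\<lambda>\<omega>. oriented_span (U \<omega>) (V \<omega>));
         X = (\<lambda>\<omega>. g_fun \<mu> (U \<omega>) \<bullet> V \<omega>);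
         planes_law = distr M oriented_planes P
     in (AE Q in planes_law. \<forall>(e1, e2) \<in> Q.
           emeasure \<mu> (orthogonal_comp (span {e1, e2}) \<inter> sphere 0 1) = 0 \<and>
           prob_space (angular_pushforward \<mu> e1 e2) \<and>
           mutually_singular (angular_pushforward \<mu> e1 e2) lebesgue_mod_pi) \<and>
        (\<exists>\<kappa>. regular_cond_law M X oriented_planes P \<kappa>) \<and>
        (\<forall>\<kappa>. regular_cond_law M X oriented_planes P \<kappa> \<longrightarrow>
           (AE Q in planes_law. \<kappa> Q = cauchy_distribution 0 1))"
proof -
  interpret M: prob_space M using haar_UV by (simp add: haar_two_frame_def)
  interpret C: prob_space "cauchy_distribution 0 1" by (rule prob_space_cauchy_distribution)
  define P where "P = (\<lambda>\<omega>. oriented_span (U \<omega>) (V \<omega>))"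
  define X where "X = (\<lambda>\<omega>. g_fun \<mu> (U \<omega>) \<bullet> V \<omega>)"
  have fr: "(\<lambda>\<omega>. (U \<omega>, V \<omega>)) \<in> measurable M frame_space"
    using haar_UV by (simp add: haar_two_frame_def)
  have P: "P \<in> measurable M oriented_planes"
    using measurable_compose[OF fr measurable_oriented_span] by (simp add: P_def)
  have [measurable]: "U \<in> borel_measurable M" "V \<in> borel_measurable M"
    using measurable_compose[OF fr measurable_frame_space_fst] measurable_compose[OF fr measurable_frame_space_snd]
    by simp_all
  note [measurable] = measurable_g_fun[OF prob_mu sets_mu]
  have X: "X \<in> borel_measurable M" unfolding X_def by measurable
  have good: "AE \<omega> in M. good_frame \<mu> (U \<omega>, V \<omega>)"
    by (rule haar_frame_good[OF prob_mu sets_mu haar_sigma I_finite haar_UV])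
  have orbit: "\<forall>w \<in> oriented_span u v. good_frame \<mu> w"
    if "(u, v) \<in> orthonormal_frames" "good_frame \<mu> (u, v)" for u v
    using oriented_span_is_orbit[OF that(1)] good_frame_rot[OF prob_mu sets_mu that] by (metis surj_pair)
  have "AE Q in distr M oriented_planes P. \<forall>w \<in> Q. good_frame \<mu> w"
  proof (subst AE_distr_iff[OF P good_planes_measurable[OF prob_mu sets_mu]])
    show "AE \<omega> in M. \<forall>w \<in> P \<omega>. good_frame \<mu> w"
      using good AE_space
    proof eventually_elim
      fix \<omega> assume "good_frame \<mu> (U \<omega>, V \<omega>)" "\<omega> \<in> space M"
      then show "\<forall>w \<in> P \<omega>. good_frame \<mu> w"
        unfolding P_def using measurable_space[OF fr] by (intro orbit) (simp add: space_frame_space)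
    qed
  qed
  then have part1: "AE Q in distr M oriented_planes P. \<forall>(e1, e2) \<in> Q.
      emeasure \<mu> (orthogonal_comp (span {e1, e2}) \<inter> sphere 0 1) = 0 \<and>
      prob_space (angular_pushforward \<mu> e1 e2) \<and>
      mutually_singular (angular_pushforward \<mu> e1 e2) lebesgue_mod_pi"
    using AE_space
  proof eventually_elim
    fix Q assume Q: "\<forall>w \<in> Q. good_frame \<mu> w" "Q \<in> space (distr M oriented_planes P)"
    show "\<forall>(e1, e2) \<in> Q. emeasure \<mu> (orthogonal_comp (span {e1, e2}) \<inter> sphere 0 1) = 0 \<and>
      prob_space (angular_pushforward \<mu> e1 e2) \<and>
      mutually_singular (angular_pushforward \<mu> e1 e2) lebesgue_mod_pi"
    proof clarify
      fix e1 e2 assume e: "(e1, e2) \<in> Q"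
      then have fr: "(e1, e2) \<in> orthonormal_frames"
        using Q(2) by (auto simp: space_oriented_planes oriented_span_def)
      have "good_frame \<mu> (e1, e2)" using Q(1) e by blast
      then show "emeasure \<mu> (orthogonal_comp (span {e1, e2}) \<inter> sphere 0 1) = 0 \<and>
        prob_space (angular_pushforward \<mu> e1 e2) \<and>
        mutually_singular (angular_pushforward \<mu> e1 e2) lebesgue_mod_pi"
        using good_frame_orthogonal_comp_null[OF prob_mu sets_mu fr]
          prob_space_angular_pushforward[OF prob_mu sets_mu fr]
          good_frame_angular_pushforward_singular[OF prob_mu sets_mu fr] by blast
    qed
  qed

  have cond: "AE \<omega> in M. real_cond_exp M (vimage_algebra (space M) P oriented_planes) (\<lambda>\<omega>'. indicator B (X \<omega>')) \<omega>
      = measure (cauchy_distribution 0 1) B" if B: "B \<in> sets borel" for B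
  proof (rule real_cond_exp_indep_indicator[OF M.prob_space_axioms X P B])
    fix S :: "'n oriented_plane set" assume "S \<in> sets oriented_planes"
    from plane_and_field_independent[OF prob_mu sets_mu haar_sigma I_finite haar_UV this B]
    show "(\<integral>\<^sup>+\<omega>. indicator S (P \<omega>) * indicator B (X \<omega>) \<partial>M) =
        ennreal (measure (cauchy_distribution 0 1) B) * (\<integral>\<^sup>+\<omega>. indicator S (P \<omega>) \<partial>M)"
      by (simp add: P_def X_def C.emeasure_eq_measure)
  qed simp

  have part2: "regular_cond_law M X oriented_planes P (\<lambda>_. cauchy_distribution 0 1)"
    unfolding regular_cond_law_def using X P cond
    by (auto simp: space_prob_algebra C.prob_space_axioms intro!: measurable_const)

  have part3: "AE Q in distr M oriented_planes P. \<kappa> Q = cauchy_distribution 0 1"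
    if \<kappa>: "regular_cond_law M X oriented_planes P \<kappa>" for \<kappa>
  proof -
    have \<kappa>m: "\<kappa> \<in> measurable oriented_planes (prob_algebra borel)"
      using \<kappa> by (simp add: regular_cond_law_def)
    have "AE Q in distr M oriented_planes P. measure (\<kappa> Q) {..q} = measure (cauchy_distribution 0 1) {..q}" for q
    proof (subst AE_distr_iff[OF P])
      have "(\<lambda>Q. measure (\<kappa> Q) {..q}) \<in> borel_measurable oriented_planes"
        by (rule measurable_compose[OF \<kappa>m measurable_measure_prob_algebra]) simp
      then show "{Q \<in> space oriented_planes. measure (\<kappa> Q) {..q} = measure (cauchy_distribution 0 1) {..q}} \<in> sets oriented_planes"
        by measurable
      have "AE \<omega> in M. real_cond_exp M (vimage_algebra (space M) P oriented_planes) (\<lambda>\<omega>'. indicator {..q} (X \<omega>')) \<omega>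
          = measure (\<kappa> (P \<omega>)) {..q}"
        using \<kappa> unfolding regular_cond_law_def by simp
      with cond[of "{..q}"] show "AE \<omega> in M. measure (\<kappa> (P \<omega>)) {..q} = measure (cauchy_distribution 0 1) {..q}"
        by (simp, elim AE_mp) (auto intro: AE_I2)
    qed
    then have "AE Q in distr M oriented_planes P. \<forall>q \<in> \<rat>. measure (\<kappa> Q) {..q} = measure (cauchy_distribution 0 1) {..q}"
      by (subst AE_ball_countable) (auto simp: countable_rat)
    then show ?thesis
      using AE_space
    proof eventually_elim
      fix Q assume eq: "\<forall>q \<in> \<rat>. measure (\<kappa> Q) {..q} = measure (cauchy_distribution 0 1) {..q}"
        and "Q \<in> space (distr M oriented_planes P)"
      then have "\<kappa> Q \<in> space (prob_algebra borel)"
        using measurable_space[OF \<kappa>m] by simp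
      then have "real_distribution (\<kappa> Q)"
        by (auto simp: space_prob_algebra real_distribution_def real_distribution_axioms_def)
      moreover have "real_distribution (cauchy_distribution 0 1)"
        by (auto simp: real_distribution_def real_distribution_axioms_def C.prob_space_axioms)
      ultimately show "\<kappa> Q = cauchy_distribution 0 1"
        using eq by (intro real_distribution_eqI_rational_cdf) auto
    qed
  qed

  show ?thesis
    unfolding Let_def P_def[symmetric] X_def[symmetric] using part1 part2 part3 by blast
qed

end
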